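(* Let $d\ge 1$ and let $Q$ be a probability measure on $\Omega=\{0,1\}^{\mathbb{Z}^d}$ such that (1) $Q$ is stationary and ergodic with respect to each of the shifts $\theta_{e_1},\dots,\theta_{e_d}$, and (2) $Q(\mathcal{P}(\omega)=\emptyset)<1$. Let $(X_n)_{n\ge 0}$ be the random walk on the discrete point process and $\mathbb{P}$ its annealed law. Then $$\mathbb{P}\left(\lim_{n\to\infty}\frac{X_n}{n}=0\right)=1.$$
   Context: Setting. $\Omega=\{0,1\}^{\mathbb{Z}^d}$ carries its product Borel $\sigma$-algebra $\mathfrak{B}$. For $x\in\mathbb{Z}^d$ the shift $\theta_x:\Omega\to\Omega$ is $(\theta_x\omega)(y)=\omega(x+y)$. $e_1,\dots,e_d$ are the standard unit vectors and $\mathcal{E}=\{\pm e_i\}_{i=1}^d$. $\mathcal{P}(\omega)=\{x\in\mathbb{Z}^d:\omega(x)=1\}$. $\Omega_0=\{\omega:\omega(0)=1\}$; under (1),(2) one has $Q(\Omega_0)>0$, and $P(\cdot)=Q(\cdot\mid\Omega_0)$. For $e\in\mathcal{E}$, $f_e(\omega)=\min\{k>0:\omega(ke)=1\}$ (for $Q$-a.e. $\omega$, $f_e(\theta_v\omega)<\infty$ for all $v\in\mathbb{Z}^d$, $e\in\mathcal{E}$). The coordinate nearest neighbors of $v\in\mathbb{Z}^d$ are $N_v(\omega)=\{v+f_e(\theta_v\omega)e:e\in\mathcal{E}\}$, a set of $2d$ points. For $P$-a.e. $\omega\in\Omega_0$, $P_\omega$ (quenched law) is the law of the Markov chain $(X_n)_{n\ge0}$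 on $\mathcal{P}(\omega)$ with $P_\omega(X_0=0)=1$ and $P_\omega(X_{n+1}=u\mid X_n=v)=\frac1{2d}$ if $u\in N_v(\omega)$ and $0$ otherwise. The annealed law $\mathbb{P}$ is the marginal on trajectories of $P(d\omega)\otimes P_\omega$, i.e. $\mathbb{P}(G)=\int P_\omega(G)\,P(d\omega)$. *)

theory Defs
  imports "HOL-Probability.Probability"
begin

section \<open>Configurations and shifts\<close>

text \<open>The lattice is \<open>int ^ 'd\<close>, so the dimension is \<open>CARD('d) \<ge> 1\<close>; the site variables take
  values in \<open>bool\<close>, with \<open>True\<close> in the role of \<open>1\<close>.\<close>

type_synonym 'd config = "int ^ 'd \<Rightarrow> bool"

definition config_space :: "'d::finite config measure" where
  "config_space = (\<Pi>\<^sub>M x\<in>UNIV. count_space UNIV)"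

definition shift :: "int ^ 'd \<Rightarrow> 'd::finite config \<Rightarrow> 'd config" where
  "shift x \<omega> = (\<lambda>y. \<omega> (x + y))"

definition stationary_ergodic :: "'a measure \<Rightarrow> ('a \<Rightarrow> 'a) \<Rightarrow> bool" where
  "stationary_ergodic M T \<longleftrightarrow>
     T \<in> measurable M M \<and> distr M M T = M \<and>
     (\<forall>A\<in>sets M. T -` A \<inter> space M = A \<longrightarrow> measure M A = 0 \<or> measure M A = 1)"

section \<open>Point process and coordinate nearest neighbors\<close>

definition points :: "'d::finite config \<Rightarrow> (int ^ 'd) set" where
  "points \<omega> = {x. \<omega> x}"

definition directions :: "(int ^ 'd::finite) set" where
  "directions = range (\<lambda>i. axis i 1) \<union> range (\<lambda>i. - axis i 1)"

text \<open>On the null set where no point is met in direction \<open>e\<close>, \<open>LEAST\<close> yields an unspecified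
  natural number.\<close>

definition gap :: "int ^ 'd \<Rightarrow> 'd::finite config \<Rightarrow> nat" where
  "gap e \<omega> = (LEAST k. 0 < k \<and> \<omega> (int k *s e))"

definition neighbors :: "'d::finite config \<Rightarrow> int ^ 'd \<Rightarrow> (int ^ 'd) set" where
  "neighbors \<omega> v = (\<lambda>e. v + int (gap e (shift v \<omega>)) *s e) ` directions"

section \<open>Quenched and annealed laws\<close>

text \<open>The law of a Markov chain with transition kernel \<open>K\<close> started at \<open>a\<close>, on the product
  sigma-algebra of the trajectory space, obtained from the Ionescu-Tulcea theorem: coordinate 0 is
  distributed as the point mass at \<open>a\<close>, and coordinate \<open>n > 0\<close>, given the past \<open>x\<close>, as
  \<open>K (x (n - 1))\<close>.\<close>

definition markov_step :: "('s \<Rightarrow> 's pmf) \<Rightarrow> 's \<Rightarrow> nat \<Rightarrow> (nat \<Rightarrow> 's) \<Rightarrow> 's measure" where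
  "markov_step K a n x = measure_pmf (if n = 0 then return_pmf a else K (x (n - 1)))"

definition markov_law :: "('s \<Rightarrow> 's pmf) \<Rightarrow> 's \<Rightarrow> (nat \<Rightarrow> 's) measure" where
  "markov_law K a =
     projective_family.lim UNIV
       (Ionescu_Tulcea.CI (markov_step K a) (\<lambda>_. count_space UNIV)) (\<lambda>_. count_space UNIV)"

text \<open>Almost surely the neighbor sets have exactly \<open>2 * CARD('d)\<close> elements
  (\<open>card_neighbors\<close> below), so that the uniform distribution on them has weights
  \<open>1 / (2 * CARD('d))\<close>.\<close>

definition quenched_law :: "'d::finite config \<Rightarrow> (nat \<Rightarrow> int ^ 'd) measure" where
  "quenched_law \<omega> = markov_law (\<lambda>v. pmf_of_set (neighbors \<omega> v)) 0"

definition palm :: "'d::finite config measure \<Rightarrow> 'd config measure" where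
  "palm Q = uniform_measure Q {\<omega> \<in> space Q. 0 \<in> points \<omega>}"

definition annealed_law :: "'d::finite config measure \<Rightarrow> (nat \<Rightarrow> int ^ 'd) measure" where
  "annealed_law Q = palm Q \<bind> quenched_law"

definition to_real_vec :: "int ^ 'd \<Rightarrow> real ^ 'd::finite" where
  "to_real_vec x = (\<chi> i. real_of_int (x $ i))"

section \<open>Basic facts about these definitions\<close>

lemma Ionescu_Tulcea_markov_step:
  "Ionescu_Tulcea (markov_step K a) (\<lambda>_. count_space UNIV)"
proof (rule Ionescu_Tulcea.intro)
  show "markov_step K a i \<in> measurable (Pi\<^sub>M {0..<i} (\<lambda>_. count_space UNIV)) (subprob_algebra (count_space UNIV))" for i
  proof (cases i)
    case 0
    have "measure_pmf (return_pmf a) \<in> space (subprob_algebra (count_space UNIV))"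
      by (simp add: space_subprob_algebra measure_pmf.subprob_space_axioms)
    with 0 show ?thesis by (simp add: markov_step_def[abs_def])
  next
    case (Suc m)
    have "(\<lambda>x. x m) \<in> measurable (Pi\<^sub>M {0..<i} (\<lambda>_. count_space UNIV)) (count_space UNIV)"
      using Suc by (intro measurable_component_singleton) auto
    moreover have "(\<lambda>v. measure_pmf (K v)) \<in> measurable (count_space UNIV) (subprob_algebra (count_space UNIV))"
      by (simp add: space_subprob_algebra measure_pmf.subprob_space_axioms)
    ultimately show ?thesis
      using Suc by (simp add: markov_step_def[abs_def] measurable_compose)
  qed
  show "prob_space (markov_step K a i x)" if "x \<in> space (Pi\<^sub>M {0..<i} (\<lambda>_. count_space UNIV))" for i x
    by (simp add: markov_step_def measure_pmf.prob_space_axioms)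
qed

interpretation markov: Ionescu_Tulcea "markov_step K a" "\<lambda>_. count_space UNIV" for K a
  by (rule Ionescu_Tulcea_markov_step)

lemma sets_markov_law [measurable_cong, simp]:
  "sets (markov_law K a) = sets (\<Pi>\<^sub>M n\<in>UNIV. count_space UNIV)"
  unfolding markov_law_def by (rule markov.PF.sets_lim)

lemma space_markov_law [simp]: "space (markov_law K a) = UNIV"
  using sets_eq_imp_space_eq[OF sets_markov_law[of K a]] by (simp add: space_PiM)

lemma markov_C_singleton:
  "emeasure (markov.C K a 0 (Suc n) (\<lambda>_. undefined)) {restrict s {0..<Suc n}} =
     ennreal (indicator {a} (s 0) * (\<Prod>i<n. pmf (K (s i)) (s (Suc i))))"
proof -
  let ?M = "\<lambda>n::nat. Pi\<^sub>M {0..<n} (\<lambda>_. count_space (UNIV::'a set))"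
  have sg: "{restrict s {0..<n}} \<in> sets (?M n)" for n
  proof -
    have "{restrict s {0..<n}} = Pi\<^sub>E {0..<n} (\<lambda>i. {s i})"
      by (auto simp: PiE_iff extensional_def restrict_def fun_eq_iff)
    then show ?thesis by (auto intro!: sets_PiM_I_finite)
  qed
  have step: "emeasure (markov.C K a 0 (Suc n) (\<lambda>_. undefined)) {restrict s {0..<Suc n}} =
     emeasure (markov.C K a 0 n (\<lambda>_. undefined)) {restrict s {0..<n}} *
     emeasure (markov_step K a n (restrict s {0..<n})) {s n}" for n
  proof -
    let ?C = "markov.C K a 0 n (\<lambda>_. undefined)"
    have setsC: "sets ?C = sets (?M n)"
      using markov.sets_C[of "\<lambda>_. undefined" 0 K a n] by simp
    have spC: "space ?C = space (?M n)"
      using setsC by (rule sets_eq_imp_space_eq)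
    have meas: "markov.eP K a n \<in> measurable ?C (subprob_algebra (?M (Suc n)))"
      using markov.measurable_eP[of K a n] setsC by (simp cong: measurable_cong_sets)
    have ne: "space ?C \<noteq> {}" unfolding spC by (simp add: space_PiM PiE_eq_empty_iff)
    have "emeasure (markov.C K a 0 (Suc n) (\<lambda>_. undefined)) {restrict s {0..<Suc n}}
        = (\<integral>\<^sup>+x. emeasure (markov.eP K a n x) {restrict s {0..<Suc n}} \<partial>?C)"
      by (simp add: emeasure_bind[OF ne meas sg])
    also have "\<dots> = (\<integral>\<^sup>+x. emeasure (markov_step K a n (restrict s {0..<n})) {s n} *
          indicator {restrict s {0..<n}} x \<partial>?C)"
    proof (intro nn_integral_cong)
      fix x assume "x \<in> space ?C"
      then have x: "x \<in> space (?M n)" using spC by simp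
      have xe: "x i = undefined" if "i \<ge> n" for i
        using x that by (auto simp: space_PiM PiE_iff extensional_def)
      have "(fun_upd x n) -` {restrict s {0..<Suc n}} \<inter> space (count_space UNIV)
            = (if x = restrict s {0..<n} then {s n} else {})"
      proof -
        have "(x(n := y) = restrict s {0..<Suc n}) \<longleftrightarrow> x = restrict s {0..<n} \<and> y = s n" for y
        proof
          assume A: "x(n := y) = restrict s {0..<Suc n}"
          have "x i = restrict s {0..<n} i" for i
            using fun_cong[OF A, of i] xe[of i] by (cases "i < n") auto
          moreover have "y = s n" using fun_cong[OF A, of n] by simp
          ultimately show "x = restrict s {0..<n} \<and> y = s n" by auto
        qed (auto simp: fun_eq_iff restrict_def)
        then show ?thesis by (auto simp: vimage_def)
      qed
      then show "emeasure (markov.eP K a n x) {restrict s {0..<Suc n}} =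
          emeasure (markov_step K a n (restrict s {0..<n})) {s n} * indicator {restrict s {0..<n}} x"
        by (simp add: markov.emeasure_eP[OF x sg])
    qed
    also have "\<dots> = emeasure (markov_step K a n (restrict s {0..<n})) {s n} *
        emeasure ?C {restrict s {0..<n}}"
      using sg[of n] setsC by (simp add: nn_integral_cmult_indicator)
    finally show ?thesis by (simp add: mult.commute)
  qed
  show ?thesis
  proof (induction n)
    case 0
    have "emeasure (markov.C K a 0 0 (\<lambda>_. undefined)) {restrict s {0..<0}} = 1"
      using sg[of 0] by (simp add: restrict_def)
    then show ?case
      unfolding step[of 0] by (simp add: markov_step_def emeasure_pmf_single indicator_def)
  next
    case (Suc n)
    show ?case
      unfolding step[of "Suc n"] Suc
      by (simp add: markov_step_def emeasure_pmf_single ennreal_mult[symmetric] prod_nonneg mult.assoc)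
  qed
qed

lemma emeasure_markov_law_cylinder:
  "emeasure (markov_law K a) {x. \<forall>i\<le>n. x i = s i} =
     ennreal (indicator {a} (s 0) * (\<Prod>i<n. pmf (K (s i)) (s (Suc i))))"
proof -
  let ?J = "{0..<Suc n}"
  have sg: "{restrict s ?J} \<in> sets (Pi\<^sub>M ?J (\<lambda>_. count_space (UNIV::'a set)))"
  proof -
    have "{restrict s ?J} = Pi\<^sub>E ?J (\<lambda>i. {s i})"
      by (auto simp: PiE_iff extensional_def restrict_def fun_eq_iff)
    then show ?thesis by (auto intro!: sets_PiM_I_finite)
  qed
  have "{x. \<forall>i\<le>n. x i = s i} = markov.PF.emb UNIV ?J {restrict s ?J}"
    by (auto simp: prod_emb_def fun_eq_iff restrict_def PiE_iff less_Suc_eq_le) metis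
  then have "emeasure (markov_law K a) {x. \<forall>i\<le>n. x i = s i} = emeasure (markov.CI K a ?J) {restrict s ?J}"
    unfolding markov_law_def using markov.lim[OF _ sg] by simp
  also have "\<dots> = emeasure (markov.C K a 0 (Suc n) (\<lambda>_. undefined)) (markov.PF.emb ?J ?J {restrict s ?J})"
    using markov.emeasure_CI[OF subset_refl sg] by simp
  also have "markov.PF.emb ?J ?J {restrict s ?J} = {restrict s ?J}"
    by (rule prod_emb_id) (auto simp: PiE_iff)
  finally show ?thesis by (simp only: markov_C_singleton)
qed

lemma prob_space_markov_law: "prob_space (markov_law K a)"
proof
  have "(\<lambda>x. restrict x {}) -` {\<lambda>_. undefined} = (UNIV :: (nat \<Rightarrow> 'a) set)"
    by (auto simp: restrict_def)
  then have "emeasure (markov_law K a) UNIV = emeasure (markov.CI K a {}) {\<lambda>_. undefined}"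
    unfolding markov_law_def
    using markov.lim[of "{}" "{\<lambda>_. undefined}" K a] by (simp add: prod_emb_def sets_PiM_empty)
  also have "\<dots> = 1"
    using prob_space.emeasure_space_1[OF markov.PF.prob_space_P[of "{}" K a]]
    by (simp add: markov.PF.space_P space_PiM)
  finally show "emeasure (markov_law K a) (space (markov_law K a)) = 1" by simp
qed

lemma finite_directions [simp]: "finite directions"
  and directions_nonempty [simp]: "directions \<noteq> {}"
  by (auto simp: directions_def)

lemma card_directions: "card (directions :: (int ^ 'd::finite) set) = 2 * CARD('d)"
proof -
  have i1: "inj (\<lambda>i::'d. axis i (1::int))"
    by (auto simp: inj_def axis_eq_axis)
  then have i2: "inj (\<lambda>i::'d. - axis i (1::int))"
    by (auto simp: inj_def)
  have "axis i (1::int) \<noteq> - axis j 1" for i j :: 'd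
  proof
    assume "axis i (1::int) = - axis j 1"
    then have "axis i (1::int) $ i = (- axis j 1) $ i" by simp
    then show False by (simp add: axis_def split: if_splits)
  qed
  then have "range (\<lambda>i::'d. axis i (1::int)) \<inter> range (\<lambda>i. - axis i 1) = {}" by auto
  then show ?thesis
    by (simp add: directions_def card_Un_disjoint card_image i1 i2)
qed

lemma card_neighbors:
  fixes \<omega> :: "'d::finite config"
  assumes "\<And>e. e \<in> directions \<Longrightarrow> \<exists>k>0. \<omega> (v + int k *s e)"
  shows "card (neighbors \<omega> v) = 2 * CARD('d)"
proof -
  let ?g = "\<lambda>e. gap e (shift v \<omega>)"
  have pos: "0 < ?g e" if "e \<in> directions" for e
    using LeastI_ex[of "\<lambda>k. 0 < k \<and> shift v \<omega> (int k *s e)"] assms[OF that]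
    by (auto simp: gap_def shift_def)
  have "inj_on (\<lambda>e. v + int (?g e) *s e) directions"
  proof (rule inj_onI)
    fix e e' :: "int ^ 'd"
    assume e: "e \<in> directions" and e': "e' \<in> directions"
      and eq: "v + int (?g e) *s e = v + int (?g e') *s e'"
    have *: "int (?g e) * e $ j = int (?g e') * e' $ j" for j
      using eq by (metis add_left_cancel vector_smult_component)
    have sgn: "sgn (e $ j) = sgn (e' $ j)" for j
      using arg_cong[OF *[of j], of sgn] pos[OF e] pos[OF e'] by (simp add: sgn_mult)
    have unit: "sgn (x $ j) = x $ j" if "x \<in> directions" for x :: "int ^ 'd" and j
      using that by (auto simp: directions_def axis_def)
    show "e = e'"
      using sgn unit[OF e] unit[OF e'] by (simp add: vec_eq_iff)
  qed
  then show ?thesis by (simp add: neighbors_def card_image card_directions)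
qed

lemma finite_neighbors [simp]: "finite (neighbors \<omega> v)"
  and neighbors_nonempty [simp]: "neighbors \<omega> v \<noteq> {}"
  by (auto simp: neighbors_def)

lemma measurable_gap [measurable]:
  "(\<lambda>\<omega>. gap e (shift v \<omega>)) \<in> measurable config_space (count_space UNIV)"
  unfolding gap_def shift_def config_space_def by measurable

lemma measurable_neighbors:
  "(\<lambda>\<omega>. neighbors \<omega> v) \<in> measurable config_space (count_space UNIV)"
proof -
  have "(\<lambda>\<omega>. neighbors \<omega> v) \<in> measurable config_space (count_space (Collect finite))"
  proof (subst measurable_count_space_eq_countable)
    show "countable (Collect finite :: (int ^ 'a) set set)"
      by (rule countable_Collect_finite)
    have "Measurable.pred config_space (\<lambda>\<omega>. \<forall>u. u \<in> neighbors \<omega> v \<longleftrightarrow> u \<in> S)" for S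
    proof -
      have [measurable]: "Measurable.pred config_space (\<lambda>\<omega>. u \<in> neighbors \<omega> v)" for u
        unfolding neighbors_def image_iff by measurable
      show ?thesis by measurable
    qed
    then have "{\<omega> \<in> space config_space. \<forall>u. u \<in> neighbors \<omega> v \<longleftrightarrow> u \<in> S} \<in> sets config_space" for S
      by (simp add: pred_def)
    moreover have "(\<lambda>\<omega>. neighbors \<omega> v) -` {S} \<inter> space config_space
        = {\<omega> \<in> space config_space. \<forall>u. u \<in> neighbors \<omega> v \<longleftrightarrow> u \<in> S}" for S
      by auto
    ultimately show "(\<lambda>\<omega>. neighbors \<omega> v) \<in> space config_space \<rightarrow> Collect finite \<and>
        (\<forall>S\<in>Collect finite. (\<lambda>\<omega>. neighbors \<omega> v) -` {S} \<inter> space config_space \<in> sets config_space)"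
      by auto
  qed
  then show ?thesis
    by (rule measurable_compose) simp
qed

lemma Int_stable_cylinders:
  "Int_stable (insert {} (range (\<lambda>(n::nat, s::nat \<Rightarrow> 's). {x. \<forall>i\<le>n. x i = s i})))"
proof -
  have "{x. \<forall>i\<le>n. x i = s i} \<inter> {x. \<forall>i\<le>m. x i = t i} \<in>
     insert {} (range (\<lambda>(n::nat, s::nat \<Rightarrow> 's). {x. \<forall>i\<le>n. x i = s i}))" (is "?A \<inter> ?B \<in> _")
    for n m s t
  proof (cases "?A \<inter> ?B = {}")
    case False
    then obtain y where "\<forall>i\<le>n. y i = s i" "\<forall>i\<le>m. y i = t i" by auto
    then have "?A \<inter> ?B = {x. \<forall>i\<le>max n m. x i = y i}"
      by (auto simp: le_max_iff_disj)
    then show ?thesis by (intro insertI2 image_eqI[of _ _ "(max n m, y)"]) auto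
  qed simp
  then show ?thesis by (auto simp: Int_stable_def)
qed

lemma sets_trajectories:
  "sets (\<Pi>\<^sub>M n\<in>(UNIV::nat set). count_space (UNIV :: 's::countable set)) =
     sigma_sets UNIV (insert {} (range (\<lambda>(n, s). {x. \<forall>i\<le>n. x i = s i})))" (is "sets ?M = sigma_sets _ ?G")
proof
  have "{x. \<forall>i\<le>n. x i = s i} \<in> sets ?M" for n and s :: "nat \<Rightarrow> 's"
  proof -
    have "{x \<in> space ?M. \<forall>i\<le>n. x i = s i} \<in> sets ?M" by measurable
    then show ?thesis by (simp add: space_PiM)
  qed
  then have "?G \<subseteq> sets ?M" by auto
  then show "sigma_sets UNIV ?G \<subseteq> sets ?M"
    using sets.sigma_sets_subset[of ?G ?M] by (simp add: space_PiM)
next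
  interpret S: sigma_algebra UNIV "sigma_sets UNIV ?G"
    by (rule sigma_algebra_sigma_sets) simp
  have coord: "{x. x i \<in> A} \<in> sigma_sets UNIV ?G" for i :: nat and A :: "'s set"
  proof -
    let ?ext = "\<lambda>l j. if j < length l then l ! j else undefined"
    let ?L = "{l. length l = Suc i \<and> l ! i \<in> A}"
    have "{x. x i \<in> A} = (\<Union>l\<in>?L. {x. \<forall>j\<le>i. x j = ?ext l j})"
    proof (intro set_eqI iffI)
      fix x assume "x \<in> {x. x i \<in> A}"
      then show "x \<in> (\<Union>l\<in>?L. {x. \<forall>j\<le>i. x j = ?ext l j})"
        by (intro UN_I[of "map x [0..<Suc i]"]) (auto simp del: upt_Suc)
    qed auto
    also have "\<dots> \<in> sigma_sets UNIV ?G"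
    proof (intro S.countable_UN')
      show "(\<lambda>l. {x. \<forall>j\<le>i. x j = ?ext l j}) ` ?L \<subseteq> sigma_sets UNIV ?G"
        by (auto intro!: sigma_sets.Basic intro: image_eqI[of _ _ "(i, _)"])
    qed auto
    finally show ?thesis .
  qed
  show "sets ?M \<subseteq> sigma_sets UNIV ?G"
    unfolding sets_PiM_single
    by (simp add: PiE_UNIV_domain, rule S.sigma_sets_subset) (auto simp: coord)
qed

lemma measurable_quenched_law:
  "quenched_law \<in> measurable config_space (prob_algebra (\<Pi>\<^sub>M n\<in>UNIV. count_space UNIV))"
proof (rule measurable_prob_algebra_generated[OF sets_trajectories Int_stable_cylinders])
  fix A :: "(nat \<Rightarrow> int ^ 'a) set"
  assume A: "A \<in> insert {} (range (\<lambda>(n::nat, s). {x. \<forall>i\<le>n. x i = s i}))"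
  have cyl: "(\<lambda>\<omega>. emeasure (quenched_law \<omega>) {x. \<forall>i\<le>n. x i = s i}) \<in> borel_measurable config_space"
    for n and s :: "nat \<Rightarrow> int ^ 'a"
  proof -
    have [measurable]: "(\<lambda>\<omega>. pmf (pmf_of_set (neighbors \<omega> v)) u) \<in> borel_measurable config_space"
      for u v :: "int ^ 'a"
      by (rule measurable_compose[OF measurable_neighbors]) simp
    show ?thesis
      unfolding quenched_law_def emeasure_markov_law_cylinder by measurable
  qed
  from A show "(\<lambda>\<omega>. emeasure (quenched_law \<omega>) A) \<in> borel_measurable config_space"
  proof (elim insertE rangeE)
    fix p assume "A = (case p of (n, s) \<Rightarrow> {x. \<forall>i\<le>n. x i = s i})"
    then have "A = {x. \<forall>i\<le>fst p. x i = snd p i}"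
      by (simp only: case_prod_unfold)
    then show ?thesis
      by (simp only: cyl)
  qed simp
qed (simp_all add: quenched_law_def prob_space_markov_law)

lemma emeasure_annealed_law:
  assumes "sets Q = sets config_space" and "A \<in> sets (\<Pi>\<^sub>M n\<in>UNIV. count_space UNIV)"
  shows "emeasure (annealed_law Q) A = (\<integral>\<^sup>+\<omega>. emeasure (quenched_law \<omega>) A \<partial>palm Q)"
proof -
  have s: "sets (palm Q) = sets config_space" using assms by (simp add: palm_def)
  then have "space (palm Q) = UNIV"
    using sets_eq_imp_space_eq[OF s] by (simp add: config_space_def space_PiM)
  moreover have "quenched_law \<in> measurable (palm Q) (subprob_algebra (\<Pi>\<^sub>M n\<in>UNIV. count_space UNIV))"
    using measurable_prob_algebraD[OF measurable_quenched_law] s by (simp cong: measurable_cong_sets)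
  ultimately show ?thesis
    unfolding annealed_law_def using assms(2) by (intro emeasure_bind) auto
qed

end

theory Submission
  imports Defs "HOL-Library.Discrete_Functions"
begin

text \<open>
  Let \<open>jump e\<close> be the shift of the configuration to the next point in direction \<open>e\<close>. Drawing i.i.d.
  uniform directions, the walk is a sum of increments along the orbit of a skew product over these
  jumps, which preserves the product of the Palm measure and the law of the directions. The jump
  along \<open>e\<close> is inverted by the one along \<open>- e\<close>, so the environment seen from the walk is reversible
  while an increment changes its sign under reversal.

  For increments truncated at \<open>M\<close>, with conditional mean \<open>a\<close> and averaging operator \<open>R\<close>, reversal gives
  \<open>E (x\<^sub>0 * x\<^bsub>m+1\<^esub>) = - <a, R^m a>\<close>. As \<open>R\<close> is a self-adjoint contraction, the sums
  \<open><a, (1 + R + ... + R^(n-1)) a>\<close> are nonnegative, so the second moment of the sum of \<open>n\<close> truncated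
  increments is at most \<open>n * M^2\<close>, which yields the strong law for them. The discarded parts are
  handled by the maximal ergodic inequality, since the gaps are integrable by Kac's lemma.
\<close>

section \<open>Maximal ergodic inequality and a strong law from second moments\<close>

text \<open>The gaps have a finite mean but need not have a second moment, so no L2 argument applies
  to the walk itself. This forces the truncation at \<open>M\<close>, and a bound on the discarded
  parts that holds for all times at once. The correlation identity comes from reversing the first
  jump alone. Given the first direction \<open>e\<close>, the later increment has mean
  \<open>R^m a\<close> at the configuration where that jump ends; seen from there, the first
  increment is the one along \<open>- e\<close> with the opposite sign. Summing over
  \<open>e\<close> leaves \<open>- <a, R^m a>\<close>. The total of all correlations is thus at most
  0, the second moment grows at most linearly, and the limit comes out as 0 directly, without
  identifying an invariant limit function. The skew product represents the walk because different
  directions lead to different neighbors, so that a uniform direction is the same as a uniform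
  neighbor.\<close>

fun max_sum :: "('a \<Rightarrow> 'a) \<Rightarrow> ('a \<Rightarrow> real) \<Rightarrow> nat \<Rightarrow> 'a \<Rightarrow> real" where
  "max_sum T f 0 x = 0"
| "max_sum T f (Suc n) x = max 0 (f x + max_sum T f n (T x))"

lemma max_sum_nonneg: "0 \<le> max_sum T f n x"
  by (cases n) auto

text \<open>\<open>max_sum T f n x\<close> is the maximum of the partial sums of lengths
  \<open>0\<close> to \<open>n\<close> along the orbit, so it grows with \<open>n\<close>. The
  recursion splits off the first term rather than the last, because this brings in
  \<open>T x\<close>.\<close>

lemma max_sum_Suc_mono: "max_sum T f n x \<le> max_sum T f (Suc n) x"
proof (induction n arbitrary: x)
  case (Suc n)
  show ?case
    using Suc.IH[of "T x"] unfolding max_sum.simps(2)[of T f n x] max_sum.simps(2)[of T f "Suc n" x]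
    by (intro max.mono add_left_mono order_refl)
qed (simp add: max_sum_nonneg)

lemma sum_le_max_sum: "(\<Sum>k<n. f ((T ^^ k) x)) \<le> max_sum T f n x"
proof (induction n arbitrary: x)
  case (Suc n)
  have "(\<Sum>k<Suc n. f ((T ^^ k) x)) = f x + (\<Sum>k<n. f ((T ^^ k) (T x)))"
    by (simp only: sum.lessThan_Suc_shift) (simp add: funpow_swap1)
  then show ?case using Suc[of "T x"] by simp
qed simp

lemma measurable_max_sum [measurable]:
  assumes [measurable]: "T \<in> measurable M M" "f \<in> borel_measurable M"
  shows "max_sum T f n \<in> borel_measurable M"
proof (induction n)
  case 0
  then show ?case by simp
next
  case (Suc n)
  note [measurable] = Suc
  have "(\<lambda>x. max 0 (f x + max_sum T f n (T x))) \<in> borel_measurable M" by measurable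
  then show ?case by (simp cong: measurable_cong)
qed

lemma integrable_max_sum:
  assumes T: "T \<in> measurable M M" "distr M M T = M" and f: "integrable M f"
  shows "integrable M (max_sum T f n)"
proof (induction n)
  case (Suc n)
  have "integrable (distr M M T) (max_sum T f n)" using Suc T by simp
  then have "integrable M (\<lambda>x. max_sum T f n (T x))" by (rule integrable_distr[OF T(1)])
  with f have "integrable M (\<lambda>x. max 0 (f x + max_sum T f n (T x)))"
    by (intro integrable_max integrable_zero Bochner_Integration.integrable_add)
  then show ?case by (simp cong: integrable_cong)
qed (simp add: integrable_zero cong: integrable_cong)

text \<open>Garsia's argument: \<open>max_sum T f n - max_sum T f n \<circ> T\<close> has integral \<open>0\<close> and is dominated by the
  integrand.\<close>

lemma maximal_ergodic:
  assumes T [measurable]: "T \<in> measurable M M" and inv: "distr M M T = M" and f: "integrable M f"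
  shows "0 \<le> (\<integral>x. f x * indicator {x. 0 < max_sum T f n x} x \<partial>M)"
proof -
  have fm [measurable]: "f \<in> borel_measurable M" using f by simp
  note I = integrable_max_sum[OF T inv f]
  have I': "integrable M (\<lambda>x. max_sum T f n (T x))"
    by (rule integrable_distr[OF T]) (simp add: inv I)
  have "(\<integral>x. max_sum T f n (T x) \<partial>M) = (\<integral>x. max_sum T f n x \<partial>distr M M T)"
    by (rule integral_distr[symmetric]) measurable
  then have "0 = (\<integral>x. max_sum T f n x - max_sum T f n (T x) \<partial>M)"
    using I I' by (simp add: inv)
  also have "\<dots> \<le> (\<integral>x. f x * indicator {x. 0 < max_sum T f n x} x \<partial>M)"
  proof (rule integral_mono)
    show "integrable M (\<lambda>x. f x * indicator {x. 0 < max_sum T f n x} x)"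
      by (rule Bochner_Integration.integrable_bound[OF f]) (auto simp: indicator_def)
    \<comment> \<open>If \<open>max_sum T f n x\<close> is positive, so is its successor, which then
      equals \<open>f x + max_sum T f n (T x)\<close>; otherwise the left side is at most 0.\<close>
    show "max_sum T f n x - max_sum T f n (T x) \<le> f x * indicator {x. 0 < max_sum T f n x} x" for x
      using max_sum_Suc_mono[of T f n x] max_sum_nonneg[of T f n "T x"] max_sum_nonneg[of T f n x]
      by (auto simp: indicator_def max_def split: if_splits)
  qed (use I I' in simp)
  finally show ?thesis .
qed

text \<open>Garsia's inequality for \<open>r - l\<close>: on the event that one of the first
  \<open>n\<close> centered partial sums is positive, \<open>r\<close> has integral at least
  \<open>l\<close> times the probability. These events increase with \<open>n\<close>, and their
  union contains the event in question.\<close>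

lemma maximal_inequality:
  assumes "prob_space M" and T [measurable]: "T \<in> measurable M M" and inv: "distr M M T = M"
    and r: "integrable M r" and r0: "\<And>x. 0 \<le> r x" and l: "0 < l"
  shows "measure M {x \<in> space M. \<exists>n. l * real n < (\<Sum>k<n. r ((T ^^ k) x))} \<le> (\<integral>x. r x \<partial>M) / l"
proof -
  interpret prob_space M by fact
  have [measurable]: "r \<in> borel_measurable M" using r by simp
  let ?f = "\<lambda>x. r x - l"
  define A where "A n = {x \<in> space M. 0 < max_sum T ?f n x}" for n
  have A [measurable]: "A n \<in> sets M" for n unfolding A_def by measurable
  have [measurable]: "T ^^ k \<in> measurable M M" for k
    using T by (induction k) (auto simp del: funpow.simps simp: funpow_Suc_right)
  have bound: "measure M (A n) \<le> (\<integral>x. r x \<partial>M) / l" for n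
  proof -
    have "0 \<le> (\<integral>x. ?f x * indicator {x. 0 < max_sum T ?f n x} x \<partial>M)"
      by (rule maximal_ergodic[OF T inv]) (use r in simp)
    also have "\<dots> = (\<integral>x. ?f x * indicator (A n) x \<partial>M)"
      by (rule Bochner_Integration.integral_cong) (auto simp: A_def indicator_def)
    \<comment> \<open>Off \<open>A n\<close> the left integrand is 0 and the right one is
      \<open>r\<close>, which is nonnegative; on \<open>A n\<close> they agree.\<close>
    also have "\<dots> \<le> (\<integral>x. r x - l * indicator (A n) x \<partial>M)"
    proof (rule integral_mono)
      show "integrable M (\<lambda>x. ?f x * indicator (A n) x)"
        by (rule Bochner_Integration.integrable_bound[of M ?f]) (use r in \<open>auto simp: indicator_def\<close>)
      show "integrable M (\<lambda>x. r x - l * indicator (A n) x)"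
        using r by (intro Bochner_Integration.integrable_diff integrable_mult_right)
          (auto simp: less_top[symmetric])
    qed (use r0 in \<open>auto simp: indicator_def\<close>)
    also have "\<dots> = (\<integral>x. r x \<partial>M) - l * measure M (A n)"
      using r by (subst Bochner_Integration.integral_diff) (auto simp: less_top[symmetric])
    finally show ?thesis using l by (simp add: field_simps)
  qed
  have "incseq A"
    unfolding A_def by (intro incseq_SucI) (use max_sum_Suc_mono[of T ?f] in \<open>force intro: less_le_trans\<close>)
  then have "(\<lambda>n. measure M (A n)) \<longlonglongrightarrow> measure M (\<Union>n. A n)"
    by (intro finite_Lim_measure_incseq) auto
  then have "measure M (\<Union>n. A n) \<le> (\<integral>x. r x \<partial>M) / l"
    by (rule LIMSEQ_le_const2) (use bound in auto)
  moreover have "measure M {x \<in> space M. \<exists>n. l * real n < (\<Sum>k<n. r ((T ^^ k) x))} \<le> measure M (\<Union>n. A n)"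
  proof (rule finite_measure_mono)
    show "{x \<in> space M. \<exists>n. l * real n < (\<Sum>k<n. r ((T ^^ k) x))} \<subseteq> (\<Union>n. A n)"
    proof clarify
      fix x n assume x: "x \<in> space M" "l * real n < (\<Sum>k<n. r ((T ^^ k) x))"
      have "(\<Sum>k<n. ?f ((T ^^ k) x)) = (\<Sum>k<n. r ((T ^^ k) x)) - l * real n"
        by (simp add: sum_subtractf)
      with x sum_le_max_sum[where n=n and T=T and f="?f" and x=x] show "x \<in> (\<Union>n. A n)"
        by (auto simp: A_def intro!: exI[of _ n])
    qed
  qed simp
  ultimately show ?thesis by linarith
qed

text \<open>Chebyshev along the squares; the bounded increments fill the gaps between them.\<close>

lemma second_moment_slln:
  fixes S :: "nat \<Rightarrow> 'a \<Rightarrow> real"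
  assumes "prob_space M" and S [measurable]: "\<And>n. S n \<in> borel_measurable M"
    and S0: "\<And>x. S 0 x = 0" and incr: "\<And>n x. \<bar>S (Suc n) x - S n x\<bar> \<le> C"
    and var: "\<And>n. (\<integral>x. (S n x)\<^sup>2 \<partial>M) \<le> real n * V"
  shows "AE x in M. (\<lambda>n. S n x / real n) \<longlonglongrightarrow> 0"
proof -
  interpret prob_space M by fact
  have C: "0 \<le> C" using incr[of 0] by (meson abs_ge_zero order_trans)
  have incr': "\<bar>S (m + k) x - S m x\<bar> \<le> real k * C" for m k x
  proof (induction k)
    case (Suc k)
    then show ?case using incr[of "m + k" x] by (simp add: algebra_simps)
  qed simp
  have bd: "(S n x)\<^sup>2 \<le> (real n * C)\<^sup>2" for n x
    using incr'[of 0 n x] C by (simp add: S0 abs_le_square_iff[symmetric])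
  have int: "integrable M (\<lambda>x. (S n x)\<^sup>2)" for n
    by (rule integrable_const_bound[of _ "(real n * C)\<^sup>2"]) (use bd in auto)
  \<comment> \<open>Sampled at the squares, the normalized sum has second moment at most
    \<open>V / n^2\<close>, which is summable. At \<open>n = 0\<close> division by zero makes both
    quantities 0.\<close>
  let ?g = "\<lambda>n x. (S (n\<^sup>2) x / real (n\<^sup>2))\<^sup>2"
  have V0: "0 \<le> V" using order_trans[OF Bochner_Integration.integral_nonneg var[of 1]] by simp
  have gint: "(\<integral>\<^sup>+x. ennreal (?g n x) \<partial>M) \<le> ennreal (V / real n ^ 2)" for n
  proof (cases "n = 0")
    case False
    have "(\<integral>\<^sup>+x. ennreal (?g n x) \<partial>M) = ennreal (\<integral>x. ?g n x \<partial>M)"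
      using int[of "n\<^sup>2"] by (intro nn_integral_eq_integral) (auto simp: power_divide)
    also have "(\<integral>x. ?g n x \<partial>M) = (\<integral>x. (S (n\<^sup>2) x)\<^sup>2 \<partial>M) / (real (n\<^sup>2))\<^sup>2"
      by (simp add: power_divide)
    also have "\<dots> \<le> (real (n\<^sup>2) * V) / (real (n\<^sup>2))\<^sup>2"
      by (intro divide_right_mono var) auto
    also have "\<dots> = V / real n ^ 2"
      using False by (simp add: power2_eq_square)
    finally show ?thesis by (simp add: ennreal_leI)
  qed (simp add: S0)
  have "(\<integral>\<^sup>+x. (\<Sum>n. ennreal (?g n x)) \<partial>M) = (\<Sum>n. \<integral>\<^sup>+x. ennreal (?g n x) \<partial>M)"
    by (intro nn_integral_suminf) measurable
  also have "\<dots> \<le> (\<Sum>n. ennreal (V / real n ^ 2))"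
    by (intro suminf_le gint summableI)
  also have "\<dots> < \<infinity>"
  proof -
    have "summable (\<lambda>n. V / real n ^ 2)"
      using summable_mult[OF inverse_power_summable[of 2, where ?'a=real], of V] by (simp add: divide_inverse)
    then show ?thesis using V0 by (subst suminf_ennreal2) auto
  qed
  finally have "AE x in M. (\<Sum>n. ennreal (?g n x)) \<noteq> \<infinity>"
    by (intro nn_integral_PInf_AE) auto
  then show ?thesis
  proof eventually_elim
    case (elim x)
    have "summable (\<lambda>n. ?g n x)" using elim by (intro summable_suminf_not_top) auto
    then have "(\<lambda>n. ?g n x) \<longlonglongrightarrow> 0" by (rule summable_LIMSEQ_zero)
    then have "(\<lambda>n. sqrt (?g n x)) \<longlonglongrightarrow> 0" using tendsto_real_sqrt by fastforce
    then have sq: "(\<lambda>n. \<bar>S (n\<^sup>2) x\<bar> / real (n\<^sup>2)) \<longlonglongrightarrow> 0" by simp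
    have fs: "filterlim floor_sqrt at_top at_top"
      unfolding filterlim_at_top eventually_at_top_linorder
      by (metis floor_sqrt_inverse_power2 mono_floor_sqrt')
    have "(\<lambda>n. 2 * C / real n) \<longlonglongrightarrow> 0" by (rule lim_const_over_n)
    with sq have "(\<lambda>n. \<bar>S (n\<^sup>2) x\<bar> / real (n\<^sup>2) + 2 * C / real n) \<longlonglongrightarrow> 0 + 0" by (rule tendsto_add)
    then have lim: "(\<lambda>n. \<bar>S ((floor_sqrt n)\<^sup>2) x\<bar> / real ((floor_sqrt n)\<^sup>2) + 2 * C / real (floor_sqrt n)) \<longlonglongrightarrow> 0"
      using filterlim_compose[OF _ fs] by fastforce
    show "(\<lambda>n. S n x / real n) \<longlonglongrightarrow> 0"
    proof (rule tendsto_rabs_zero_cancel, rule tendsto_sandwich[OF _ _ tendsto_const lim])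
      show "\<forall>\<^sub>F n in sequentially. 0 \<le> \<bar>S n x / real n\<bar>" by simp
      show "\<forall>\<^sub>F n in sequentially. \<bar>S n x / real n\<bar>
          \<le> \<bar>S ((floor_sqrt n)\<^sup>2) x\<bar> / real ((floor_sqrt n)\<^sup>2) + 2 * C / real (floor_sqrt n)"
      proof (rule eventually_sequentiallyI[of 1])
        fix n :: nat assume n: "1 \<le> n"
        define m where "m = floor_sqrt n"
        have m: "m\<^sup>2 \<le> n" "n < (Suc m)\<^sup>2" "0 < m"
          using n by (auto simp: m_def floor_sqrt_power2_le Suc_floor_sqrt_power2_gt)
        \<comment> \<open>Consecutive squares differ by \<open>2 * m + 1\<close>. The at most
          \<open>2 * m\<close> increments after time \<open>m^2\<close>, each bounded by
          \<open>C\<close> and divided by \<open>m^2\<close>, produce the error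
          \<open>2 * C / m\<close>.\<close>
        then have nm: "n - m\<^sup>2 \<le> 2 * m" by (simp add: power2_eq_square)
        have "\<bar>S n x - S (m\<^sup>2) x\<bar> \<le> real (n - m\<^sup>2) * C"
          using incr'[of "m\<^sup>2" "n - m\<^sup>2" x] m by simp
        also have "\<dots> \<le> real (2 * m) * C"
          using nm C by (intro mult_right_mono) (auto simp del: of_nat_mult)
        finally have "\<bar>S n x\<bar> \<le> \<bar>S (m\<^sup>2) x\<bar> + 2 * real m * C" by simp
        then have "\<bar>S n x / real n\<bar> \<le> (\<bar>S (m\<^sup>2) x\<bar> + 2 * real m * C) / real n"
          by (simp add: abs_divide divide_right_mono)
        also have "\<dots> \<le> (\<bar>S (m\<^sup>2) x\<bar> + 2 * real m * C) / real (m\<^sup>2)"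
          using m C n by (intro divide_left_mono mult_pos_pos) (auto simp del: of_nat_power)
        also have "\<dots> = \<bar>S (m\<^sup>2) x\<bar> / real (m\<^sup>2) + 2 * C / real m"
          using m by (simp add: field_simps power2_eq_square)
        finally show "\<bar>S n x / real n\<bar> \<le> \<bar>S ((floor_sqrt n)\<^sup>2) x\<bar> / real ((floor_sqrt n)\<^sup>2) + 2 * C / real (floor_sqrt n)"
          unfolding m_def .
      qed
    qed
  qed
qed

section \<open>Recurrence, gaps and reversibility\<close>

lemma space_config_space [simp]: "space config_space = UNIV"
  by (simp add: config_space_def space_PiM)

lemma measurable_site [measurable]: "(\<lambda>\<omega>. \<omega> x) \<in> measurable config_space (count_space UNIV)"
  unfolding config_space_def by measurable

lemma Collect_config_sets:
  "Measurable.pred config_space R \<Longrightarrow> {\<omega>. R \<omega>} \<in> sets config_space"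
  by (simp add: pred_def)

lemma measurable_shift [measurable]: "shift x \<in> measurable config_space config_space"
proof -
  have "(\<lambda>\<omega> y. \<omega> (x + y)) \<in> measurable config_space (\<Pi>\<^sub>M y\<in>UNIV. count_space UNIV)"
    by (rule measurable_PiM_single') (auto simp: space_PiM)
  then show ?thesis by (simp add: shift_def[abs_def] config_space_def[symmetric])
qed

lemma shift_apply: "shift x \<omega> y = \<omega> (x + y)"
  by (simp add: shift_def)

lemma shift_zero [simp]: "shift 0 \<omega> = \<omega>"
  by (simp add: shift_def)

lemma shift_shift [simp]: "shift x (shift y \<omega>) = shift (y + x) \<omega>"
  by (simp add: shift_def add.assoc)

definition jump :: "int ^ 'd \<Rightarrow> 'd::finite config \<Rightarrow> 'd config" where
  "jump e \<omega> = shift (int (gap e \<omega>) *s e) \<omega>"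

lemma measurable_gap' [measurable]: "gap e \<in> measurable config_space (count_space UNIV)"
  using measurable_gap[of e 0] by simp

lemma measurable_jump [measurable]: "jump e \<in> measurable config_space config_space"
  unfolding jump_def[abs_def]
  by (rule measurable_compose_countable[of "\<lambda>k. shift (int k *s e)"]) measurable

text \<open>On a ray without points \<open>gap\<close> is an unspecified number, whereas this
  predicate is then false for every \<open>k\<close>. It involves finitely many sites, which makes
  it easy to translate and to reflect.\<close>

definition first_at :: "int ^ 'd \<Rightarrow> nat \<Rightarrow> 'd::finite config \<Rightarrow> bool" where
  "first_at e k \<omega> \<longleftrightarrow> 0 < k \<and> \<omega> (int k *s e) \<and> (\<forall>j. 0 < j \<and> j < k \<longrightarrow> \<not> \<omega> (int j *s e))"

lemma measurable_first_at [measurable]: "Measurable.pred config_space (first_at e k)"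
  unfolding first_at_def[abs_def] by measurable

lemma first_at_gap:
  assumes ex: "\<exists>k>0. \<omega> (int k *s e)"
  shows "first_at e k \<omega> \<longleftrightarrow> gap e \<omega> = k"
proof
  assume "first_at e k \<omega>"
  then show "gap e \<omega> = k"
    unfolding first_at_def gap_def by (intro Least_equality) (auto simp: not_less[symmetric])
next
  assume k: "gap e \<omega> = k"
  show "first_at e k \<omega>"
    using LeastI_ex[of "\<lambda>k. 0 < k \<and> \<omega> (int k *s e)"] ex k
      not_less_Least[of _ "\<lambda>k. 0 < k \<and> \<omega> (int k *s e)"]
    unfolding first_at_def gap_def by blast
qed

lemma site_gap:
  assumes "\<exists>k>0. \<omega> (int k *s e)"
  shows "\<omega> (int (gap e \<omega>) *s e)"
  using first_at_gap[OF assms, of "gap e \<omega>"] by (simp_all add: first_at_def)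

section \<open>Stationary fields: recurrence, Kac's lemma and reversal\<close>

locale stationary_field = prob_space Q for Q :: "'d::finite config measure" +
  assumes sets_Q [simp, measurable_cong]: "sets Q = sets config_space"
    and stationary: "distr Q Q (shift x) = Q"
begin

lemma space_Q [simp]: "space Q = UNIV"
  using sets_eq_imp_space_eq[OF sets_Q] by simp

lemma emeasure_shift:
  assumes [measurable]: "Measurable.pred config_space R"
  shows "emeasure Q {\<omega>. R (shift x \<omega>)} = emeasure Q {\<omega>. R \<omega>}"
proof -
  have "emeasure Q {\<omega>. R \<omega>} = emeasure (distr Q Q (shift x)) {\<omega>. R \<omega>}" by (simp add: stationary)
  also have "\<dots> = emeasure Q (shift x -` {\<omega>. R \<omega>} \<inter> space Q)"
    using Collect_config_sets[OF assms] by (intro emeasure_distr) simp_all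
  finally show ?thesis by (simp add: vimage_def)
qed

lemma AE_shift:
  assumes [measurable]: "Measurable.pred config_space R" and "AE \<omega> in Q. R \<omega>"
  shows "AE \<omega> in Q. R (shift x \<omega>)"
proof -
  have [simp]: "{\<omega>. \<not> R \<omega>} \<in> sets config_space" "{\<omega>. \<not> R (shift x \<omega>)} \<in> sets config_space"
    by (rule Collect_config_sets, measurable)+
  have "emeasure Q {\<omega>. \<not> R \<omega>} = 0"
    using assms(2) AE_iff_measurable[of "{\<omega>. \<not> R \<omega>}" Q R] by simp
  then have "emeasure Q {\<omega>. \<not> R (shift x \<omega>)} = 0"
    using emeasure_shift[of "\<lambda>\<omega>. \<not> R \<omega>" x] by simp
  then show ?thesis using AE_iff_measurable[of "{\<omega>. \<not> R (shift x \<omega>)}" Q "\<lambda>\<omega>. R (shift x \<omega>)"] by simp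
qed

text \<open>Infinitely many disjoint events of equal probability fit into a probability space only
  if that probability is 0. This is the form of Poincare recurrence used for the point
  process.\<close>

lemma disjoint_translates_null:
  fixes R :: "'d config \<Rightarrow> bool" and x :: "nat \<Rightarrow> int ^ 'd"
  assumes [measurable]: "Measurable.pred config_space R"
    and disj: "\<And>j k \<omega>. R (shift (x j) \<omega>) \<Longrightarrow> R (shift (x k) \<omega>) \<Longrightarrow> j = k"
  shows "AE \<omega> in Q. \<not> R \<omega>"
proof -
  have "(\<lambda>j. measure Q {\<omega>. R (shift (x j) \<omega>)}) sums measure Q (\<Union>j. {\<omega>. R (shift (x j) \<omega>)})"
  proof (rule finite_measure_UNION)
    show "range (\<lambda>j. {\<omega>. R (shift (x j) \<omega>)}) \<subseteq> sets Q"
      unfolding sets_Q by (intro image_subsetI Collect_config_sets) measurable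
    show "disjoint_family (\<lambda>j. {\<omega>. R (shift (x j) \<omega>)})"
      unfolding disjoint_family_on_def using disj by blast
  qed
  moreover have "measure Q {\<omega>. R (shift (x j) \<omega>)} = measure Q {\<omega>. R \<omega>}" for j
    using emeasure_shift[OF assms(1), of "x j"] by (simp add: measure_def)
  ultimately have "summable (\<lambda>j::nat. measure Q {\<omega>. R \<omega>})"
    by (auto dest: sums_summable)
  then have "emeasure Q {\<omega>. R \<omega>} = 0"
    by (simp add: summable_const_iff emeasure_eq_measure)
  moreover have "{\<omega>. R \<omega>} \<in> sets Q"
    unfolding sets_Q by (rule Collect_config_sets) fact
  ultimately show ?thesis using AE_iff_measurable[of "{\<omega>. R \<omega>}" Q "\<lambda>\<omega>. \<not> R \<omega>"] by simp
qed

text \<open>The exceptional event says that the origin is the last point in direction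
  \<open>e\<close>. For at most one \<open>j\<close> can the site \<open>int j *s e\<close> be last,
  so the translates of this event are disjoint.\<close>

lemma recurrent_origin: "AE \<omega> in Q. \<omega> 0 \<longrightarrow> (\<exists>k>0. \<omega> (int k *s e))"
proof -
  let ?R = "\<lambda>\<omega>::'d config. \<omega> 0 \<and> (\<forall>k>0. \<not> \<omega> (int k *s e))"
  have "AE \<omega> in Q. \<not> ?R \<omega>"
  proof (rule disjoint_translates_null[where x="\<lambda>j. int j *s e"])
    fix j k :: nat and \<omega> :: "'d config"
    have *: "\<not> k < j" if "?R (shift (int k *s e) \<omega>)" "?R (shift (int j *s e) \<omega>)" for j k
    proof
      assume kj: "k < j"
      then have "int k *s e + int (j - k) *s e = int j *s e"
        by (simp flip: vector_sadd_rdistrib add: of_nat_diff)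
      moreover have "\<not> \<omega> (int k *s e + int (j - k) *s e)"
        using kj that(1) by (simp only: shift_apply) simp
      ultimately show False using that(2) by (simp add: shift_apply)
    qed
    assume "?R (shift (int j *s e) \<omega>)" "?R (shift (int k *s e) \<omega>)"
    then show "j = k" using * by (metis linorder_neqE_nat)
  qed measurable
  then show ?thesis by eventually_elim auto
qed

lemma recurrent:
  "AE \<omega> in Q. \<forall>v. \<omega> v \<longrightarrow> (\<forall>e\<in>directions. \<exists>k>0. \<omega> (v + int k *s e))"
proof -
  have "AE \<omega> in Q. \<omega> v \<longrightarrow> (\<exists>k>0. \<omega> (v + int k *s e))" for v e
    using AE_shift[OF _ recurrent_origin[of e], of v] by (simp add: shift_apply)
  then have "AE \<omega> in Q. \<forall>v e. \<omega> v \<longrightarrow> (\<exists>k>0. \<omega> (v + int k *s e))"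
    unfolding AE_all_countable by blast
  then show ?thesis by eventually_elim blast
qed

text \<open>Kac's lemma: translating \<open>{\<omega> 0, gap > k}\<close> by \<open>k *s e\<close> yields disjoint events.\<close>

lemma nn_integral_gap_le: "(\<integral>\<^sup>+\<omega>. of_nat (gap e \<omega>) * indicator {\<omega>. \<omega> 0} \<omega> \<partial>Q) \<le> 1"
proof -
  \<comment> \<open>\<open>R k\<close> says that the nearest point at or behind the origin lies
    exactly \<open>k\<close> steps back. Counting starts at \<open>k = 0\<close>, the origin itself,
    in accordance with \<open>gap\<close> being the number of \<open>k < gap\<close>. Different
    \<open>k\<close> exclude each other, whence the bound 1.\<close>
  define R where "R k \<omega> \<longleftrightarrow> \<omega> (- (int k *s e)) \<and> (\<forall>j<k. \<not> \<omega> (- (int j *s e)))" for k and \<omega> :: "'d config"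
  have [measurable]: "Measurable.pred config_space (R k)" for k
    unfolding R_def by measurable
  have tr: "{\<omega>. \<omega> 0 \<and> k < gap e \<omega>} \<subseteq> {\<omega>. R k (shift (int k *s e) \<omega>)}" for k
  proof clarify
    fix \<omega> :: "'d config" assume \<omega>: "\<omega> 0" "k < gap e \<omega>"
    have "\<not> \<omega> (int k *s e + - (int j *s e))" if "j < k" for j
    proof -
      have "int k *s e + - (int j *s e) = int (k - j) *s e"
        using that by (simp add: of_nat_diff vector_sub_rdistrib)
      moreover have "k - j < gap e \<omega>" "0 < k - j" using \<omega> that by auto
      then have "\<not> \<omega> (int (k - j) *s e)" unfolding gap_def by (blast dest: not_less_Least)
      ultimately show ?thesis by simp
    qed
    with \<omega> show "R k (shift (int k *s e) \<omega>)" by (simp add: R_def shift_apply)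
  qed
  have "(of_nat n :: ennreal) = (\<Sum>k. indicator {..<n} k)" for n :: nat
  proof -
    have "(\<Sum>k. indicator {..<n} k) = (\<Sum>k<n. indicator {..<n} k :: ennreal)"
      by (rule suminf_finite) auto
    then show ?thesis by simp
  qed
  then have "(\<integral>\<^sup>+\<omega>. of_nat (gap e \<omega>) * indicator {\<omega>. \<omega> 0} \<omega> \<partial>Q)
      = (\<integral>\<^sup>+\<omega>. (\<Sum>k. indicator {\<omega>. \<omega> 0 \<and> k < gap e \<omega>} \<omega>) \<partial>Q)"
    by (intro nn_integral_cong) (auto simp: indicator_def)
  also have "\<dots> = (\<Sum>k. emeasure Q {\<omega>. \<omega> 0 \<and> k < gap e \<omega>})"
  proof -
    have [simp]: "{\<omega>. \<omega> 0 \<and> k < gap e \<omega>} \<in> sets config_space" for k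
      by (rule Collect_config_sets) measurable
    show ?thesis by (subst nn_integral_suminf) simp_all
  qed
  also have "\<dots> \<le> (\<Sum>k. emeasure Q {\<omega>. R k \<omega>})"
  proof (intro suminf_le summableI)
    fix k
    have "{\<omega>. R k (shift (int k *s e) \<omega>)} \<in> sets Q"
      using measurable_compose[OF measurable_shift \<open>Measurable.pred config_space (R k)\<close>]
      by (simp add: pred_def)
    then have "emeasure Q {\<omega>. \<omega> 0 \<and> k < gap e \<omega>} \<le> emeasure Q {\<omega>. R k (shift (int k *s e) \<omega>)}"
      by (intro emeasure_mono tr)
    then show "emeasure Q {\<omega>. \<omega> 0 \<and> k < gap e \<omega>} \<le> emeasure Q {\<omega>. R k \<omega>}"
      by (simp add: emeasure_shift)
  qed
  also have "\<dots> = emeasure Q (\<Union>k. {\<omega>. R k \<omega>})"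
  proof (intro suminf_emeasure)
    have "i = j" if "R i \<omega>" "R j \<omega>" for i j \<omega>
      using that unfolding R_def by (metis linorder_neqE_nat)
    then show "disjoint_family (\<lambda>k. {\<omega>. R k \<omega>})"
      unfolding disjoint_family_on_def by blast
    show "range (\<lambda>k. {\<omega>. R k \<omega>}) \<subseteq> sets Q"
      unfolding sets_Q by (intro image_subsetI Collect_config_sets) measurable
  qed
  also have "\<dots> \<le> 1" by (rule emeasure_le_1)
  finally show ?thesis .
qed

text \<open>Reversibility: the jump along \<open>e\<close> across a gap of length \<open>k\<close>, seen from its end point,
  is the jump along \<open>- e\<close>.\<close>

lemma emeasure_reversal:
  fixes A :: "nat \<Rightarrow> 'd config \<Rightarrow> 'd config \<Rightarrow> bool"
  assumes A [measurable]: "\<And>k. Measurable.pred (config_space \<Otimes>\<^sub>M config_space) (\<lambda>(\<omega>, \<omega>'). A k \<omega> \<omega>')"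
  shows "emeasure Q {\<omega>. \<omega> 0 \<and> A (gap e \<omega>) \<omega> (jump e \<omega>)} =
    emeasure Q {\<omega>. \<omega> 0 \<and> A (gap (- e) \<omega>) (jump (- e) \<omega>) \<omega>}"
proof -
  have A' [measurable]: "Measurable.pred config_space (\<lambda>\<omega>. A k (f \<omega>) (g \<omega>))"
    if [measurable]: "f \<in> measurable config_space config_space" "g \<in> measurable config_space config_space" for k f g
    using measurable_compose[OF measurable_Pair[OF that] A[of k]] by simp
  have AA [measurable]: "Measurable.pred config_space (\<lambda>\<omega>. A (gap e \<omega>) (f \<omega>) (g \<omega>))"
    if [measurable]: "f \<in> measurable config_space config_space" "g \<in> measurable config_space config_space" for e f g
    by (rule measurable_compose_countable[of "\<lambda>k \<omega>. A k (f \<omega>) (g \<omega>)"]) measurable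
  \<comment> \<open>Cutting the event by the value of the gap turns the jump into a fixed shift on
    each piece, to which stationarity applies. The pieces exhaust the event up to the null set where
    the origin is a point with none ahead.\<close>
  have split: "emeasure Q {\<omega>. \<omega> 0 \<and> B (gap e \<omega>) \<omega>} = (\<Sum>k. emeasure Q {\<omega>. \<omega> 0 \<and> first_at e k \<omega> \<and> B k \<omega>})"
    if [measurable]: "\<And>k. Measurable.pred config_space (B k)" for B e
  proof -
    have [measurable]: "Measurable.pred config_space (\<lambda>\<omega>. B (gap e \<omega>) \<omega>)"
      by (rule measurable_compose_countable[of B]) measurable
    have "emeasure Q {\<omega>. \<omega> 0 \<and> B (gap e \<omega>) \<omega>} = emeasure Q (\<Union>k. {\<omega>. \<omega> 0 \<and> first_at e k \<omega> \<and> B k \<omega>})"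
    proof (rule emeasure_eq_AE)
      show "AE \<omega> in Q. \<omega> \<in> {\<omega>. \<omega> 0 \<and> B (gap e \<omega>) \<omega>} \<longleftrightarrow> \<omega> \<in> (\<Union>k. {\<omega>. \<omega> 0 \<and> first_at e k \<omega> \<and> B k \<omega>})"
        using recurrent_origin[of e] proof eventually_elim
          case (elim \<omega>)
          then show ?case by (cases "\<omega> 0") (simp_all add: first_at_gap)
        qed
      show "{\<omega>. \<omega> 0 \<and> B (gap e \<omega>) \<omega>} \<in> sets Q"
        unfolding sets_Q by (rule Collect_config_sets) measurable
      show "(\<Union>k. {\<omega>. \<omega> 0 \<and> first_at e k \<omega> \<and> B k \<omega>}) \<in> sets Q"
        unfolding sets_Q by (intro sets.countable_UN image_subsetI Collect_config_sets) measurable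
    qed
    also have "\<dots> = (\<Sum>k. emeasure Q {\<omega>. \<omega> 0 \<and> first_at e k \<omega> \<and> B k \<omega>})"
    proof (intro suminf_emeasure[symmetric])
      have "i = j" if "first_at e i \<omega>" "first_at e j \<omega>" for i j \<omega>
        using that unfolding first_at_def by (metis linorder_neqE_nat)
      then show "disjoint_family (\<lambda>k. {\<omega>. \<omega> 0 \<and> first_at e k \<omega> \<and> B k \<omega>})"
        unfolding disjoint_family_on_def by blast
      show "range (\<lambda>k. {\<omega>. \<omega> 0 \<and> first_at e k \<omega> \<and> B k \<omega>}) \<subseteq> sets Q"
        unfolding sets_Q by (intro image_subsetI Collect_config_sets) measurable
    qed
    finally show ?thesis .
  qed
  define L where "L k \<omega> \<longleftrightarrow> \<omega> 0 \<and> first_at (- e) k \<omega> \<and> A k (shift (int k *s (- e)) \<omega>) \<omega>" for k \<omega>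
  have L [measurable]: "Measurable.pred config_space (L k)" for k
    unfolding L_def by measurable
  have shift_L: "L k (shift (int k *s e) \<omega>) \<longleftrightarrow> \<omega> 0 \<and> first_at e k \<omega> \<and> A k \<omega> (shift (int k *s e) \<omega>)" for k \<omega>
  proof -
    have neg: "int k *s e + int j *s (- e) = int (k - j) *s e" if "j \<le> k" for j
      using that by (simp add: of_nat_diff vec_eq_iff algebra_simps)
    \<comment> \<open>Replacing \<open>j\<close> by \<open>k - j\<close> permutes the interior sites
      of the gap, so their emptiness reads the same from either end.\<close>
    have "(\<forall>j. 0 < j \<and> j < k \<longrightarrow> \<not> \<omega> (int (k - j) *s e)) \<longleftrightarrow> (\<forall>j. 0 < j \<and> j < k \<longrightarrow> \<not> \<omega> (int j *s e))"
    proof (intro iffI allI impI)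
      fix j assume *: "\<forall>j. 0 < j \<and> j < k \<longrightarrow> \<not> \<omega> (int (k - j) *s e)" and j: "0 < j \<and> j < k"
      from j have "0 < k - j \<and> k - j < k" by simp
      with * have "\<not> \<omega> (int (k - (k - j)) *s e)" by blast
      with j show "\<not> \<omega> (int j *s e)" by simp
    next
      fix j assume *: "\<forall>j. 0 < j \<and> j < k \<longrightarrow> \<not> \<omega> (int j *s e)" and j: "0 < j \<and> j < k"
      from j have "0 < k - j \<and> k - j < k" by simp
      with * show "\<not> \<omega> (int (k - j) *s e)" by blast
    qed
    moreover have "(\<forall>j. 0 < j \<and> j < k \<longrightarrow> \<not> \<omega> (int k *s e + int j *s (- e))) \<longleftrightarrow>
        (\<forall>j. 0 < j \<and> j < k \<longrightarrow> \<not> \<omega> (int (k - j) *s e))"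
      using neg by (metis less_imp_le)
    moreover have "int k *s e + int k *s (- e) = 0" using neg[of k] by simp
    ultimately show ?thesis
      unfolding L_def first_at_def by (simp add: shift_apply) blast
  qed
  have "emeasure Q {\<omega>. \<omega> 0 \<and> A (gap e \<omega>) \<omega> (jump e \<omega>)} =
      (\<Sum>k. emeasure Q {\<omega>. \<omega> 0 \<and> first_at e k \<omega> \<and> A k \<omega> (shift (int k *s e) \<omega>)})"
    unfolding jump_def by (rule split) measurable
  also have "\<dots> = (\<Sum>k. emeasure Q {\<omega>. L k \<omega>})"
    unfolding shift_L[symmetric] by (simp add: emeasure_shift)
  also have "\<dots> = emeasure Q {\<omega>. \<omega> 0 \<and> A (gap (- e) \<omega>) (jump (- e) \<omega>) \<omega>}"
    unfolding jump_def L_def by (rule split[symmetric]) measurable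
  finally show ?thesis .
qed

lemma origin_sets [measurable]: "{\<omega>. \<omega> 0} \<in> sets config_space"
  by (rule Collect_config_sets) measurable

end

section \<open>The Palm measure and its reversibility\<close>

locale stationary_points = stationary_field Q for Q :: "'d::finite config measure" +
  assumes origin_pos: "emeasure Q {\<omega>. \<omega> 0} \<noteq> 0"
begin

lemma sets_palm [simp, measurable_cong]: "sets (palm Q) = sets config_space"
  by (simp add: palm_def)

lemma space_palm [simp]: "space (palm Q) = UNIV"
  by (simp add: palm_def)

lemma prob_space_palm: "prob_space (palm Q)"
  unfolding palm_def points_def using origin_pos
  by (intro prob_space_uniform_measure) (simp_all add: emeasure_finite)

lemma emeasure_palm:
  assumes [measurable]: "Measurable.pred config_space R"
  shows "emeasure (palm Q) {\<omega>. R \<omega>} = emeasure Q {\<omega>. \<omega> 0 \<and> R \<omega>} / emeasure Q {\<omega>. \<omega> 0}"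
proof -
  have "{\<omega>. R \<omega>} \<in> sets config_space" by (rule Collect_config_sets) measurable
  then show ?thesis by (simp add: palm_def points_def Collect_conj_eq)
qed

lemma AE_palmI:
  assumes "AE \<omega> in Q. \<omega> 0 \<longrightarrow> R \<omega>"
  shows "AE \<omega> in palm Q. R \<omega>"
  unfolding palm_def points_def using assms by (intro AE_uniform_measureI) auto

text \<open>The joint law of gap, start and end is compared, so that one identity yields the
  invariance of the Palm measure under \<open>jump\<close>, the symmetry of the averaging operator
  and the sign change of the scores.\<close>

lemma distr_reversal:
  "distr (palm Q) (count_space UNIV \<Otimes>\<^sub>M (config_space \<Otimes>\<^sub>M config_space)) (\<lambda>\<omega>. (gap e \<omega>, \<omega>, jump e \<omega>)) =
   distr (palm Q) (count_space UNIV \<Otimes>\<^sub>M (config_space \<Otimes>\<^sub>M config_space)) (\<lambda>\<omega>. (gap (- e) \<omega>, jump (- e) \<omega>, \<omega>))"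
  (is "distr _ ?N ?f = distr _ ?N ?g")
proof (rule measure_eqI)
  fix A assume "A \<in> sets (distr (palm Q) ?N ?f)"
  then have A [measurable]: "A \<in> sets ?N" by simp
  have "emeasure Q {\<omega>. \<omega> 0 \<and> (gap e \<omega>, \<omega>, jump e \<omega>) \<in> A} =
      emeasure Q {\<omega>. \<omega> 0 \<and> (gap (- e) \<omega>, jump (- e) \<omega>, \<omega>) \<in> A}"
  proof (rule emeasure_reversal[where A="\<lambda>k \<omega> \<omega>'. (k, \<omega>, \<omega>') \<in> A"])
    show "Measurable.pred (config_space \<Otimes>\<^sub>M config_space) (\<lambda>(\<omega>, \<omega>'). (k, \<omega>, \<omega>') \<in> A)" for k
      by measurable
  qed
  moreover have "emeasure (distr (palm Q) ?N ?f) A = emeasure (palm Q) {\<omega>. (gap e \<omega>, \<omega>, jump e \<omega>) \<in> A}"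
    by (subst emeasure_distr) (simp_all add: vimage_def)
  moreover have "emeasure (distr (palm Q) ?N ?g) A = emeasure (palm Q) {\<omega>. (gap (- e) \<omega>, jump (- e) \<omega>, \<omega>) \<in> A}"
    by (subst emeasure_distr) (simp_all add: vimage_def)
  ultimately show "emeasure (distr (palm Q) ?N ?f) A = emeasure (distr (palm Q) ?N ?g) A"
    by (simp add: emeasure_palm)
qed simp

end

section \<open>The walk driven by independent directions\<close>

abbreviation direction_law :: "(int ^ 'd::finite) measure" where
  "direction_law \<equiv> measure_pmf (pmf_of_set directions)"

definition driver_law :: "(nat \<Rightarrow> int ^ 'd::finite) measure" where
  "driver_law = (\<Pi>\<^sub>M n\<in>UNIV. direction_law)"

interpretation driver: sequence_space "direction_law :: (int ^ 'd::finite) measure"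
  by unfold_locales

lemma sets_driver_law [measurable_cong]:
  "sets driver_law = sets (\<Pi>\<^sub>M n\<in>UNIV. count_space UNIV)"
  unfolding driver_law_def by (rule sets_PiM_cong) simp_all

lemma space_driver_law [simp]: "space driver_law = UNIV"
  by (simp add: driver_law_def space_PiM)

lemma prob_space_driver_law: "prob_space driver_law"
  unfolding driver_law_def by (rule driver.P.prob_space_axioms)

lemma measurable_driver [measurable]: "(\<lambda>U. U n) \<in> measurable driver_law (count_space UNIV)"
proof -
  have "(\<lambda>U. U n) \<in> measurable (\<Pi>\<^sub>M n\<in>UNIV. count_space UNIV) (count_space UNIV)"
    by (rule measurable_component_singleton) simp
  then show ?thesis by (simp cong: measurable_cong_sets add: sets_driver_law)
qed

lemma measurable_into_driver:
  assumes "\<And>n. (\<lambda>x. f x n) \<in> measurable M (count_space UNIV)"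
  shows "f \<in> measurable M driver_law"
proof -
  have "(\<lambda>x n. f x n) \<in> measurable M (\<Pi>\<^sub>M n\<in>UNIV. count_space UNIV)"
    by (rule measurable_PiM_single') (use assms in \<open>auto simp: space_PiM\<close>)
  then show ?thesis by (simp cong: measurable_cong_sets add: sets_driver_law)
qed

lemma measurable_case_nat_driver [measurable]: "case_nat e \<in> measurable driver_law driver_law"
  by (rule measurable_into_driver) (auto split: nat.split)

lemma AE_driver: "AE U in driver_law. \<forall>n. U n \<in> directions"
  unfolding AE_all_countable driver_law_def
  by (intro allI AE_PiM_component)
    (simp_all add: measure_pmf.prob_space_axioms AE_measure_pmf_iff)

lemma distr_driver:
  "distr (direction_law \<Otimes>\<^sub>M driver_law) driver_law (\<lambda>(e, U). case_nat e U) = driver_law"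
  using driver.PiM_iter by (simp add: driver_law_def)

lemma measurable_case_nat_pair [measurable]:
  "(\<lambda>(e, U). case_nat e U) \<in> measurable (direction_law \<Otimes>\<^sub>M driver_law) driver_law"
  by (rule measurable_into_driver) (auto split: nat.split intro: measurable_compose[OF measurable_snd])

text \<open>One-step analysis: the first direction is uniform and independent of the remaining
  sequence, which has the same law as the whole.\<close>

lemma nn_integral_driver:
  assumes [measurable]: "F \<in> borel_measurable driver_law"
  shows "(\<integral>\<^sup>+U. F U \<partial>driver_law) =
    (\<Sum>e\<in>(directions :: (int ^ 'd::finite) set). \<integral>\<^sup>+U. F (case_nat e U) \<partial>driver_law) / of_nat (2 * CARD('d))"
proof -
  interpret S: prob_space "driver_law :: (nat \<Rightarrow> int ^ 'd) measure" by (rule prob_space_driver_law)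
  have "(\<integral>\<^sup>+U. F U \<partial>driver_law) = (\<integral>\<^sup>+p. F (case p of (e, U) \<Rightarrow> case_nat e U) \<partial>(direction_law \<Otimes>\<^sub>M driver_law))"
    by (subst distr_driver[symmetric], rule nn_integral_distr) measurable
  also have "\<dots> = (\<integral>\<^sup>+e. \<integral>\<^sup>+U. F (case_nat e U) \<partial>driver_law \<partial>direction_law)"
    by (subst S.nn_integral_fst[symmetric]) simp_all
  finally show ?thesis
    by (simp add: nn_integral_pmf_of_set card_directions)
qed

lemma integral_driver:
  fixes F :: "(nat \<Rightarrow> int ^ 'd::finite) \<Rightarrow> real"
  assumes [measurable]: "F \<in> borel_measurable driver_law" and bd: "\<And>U. \<bar>F U\<bar> \<le> B"
  shows "(\<integral>U. F U \<partial>driver_law) =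
    (\<Sum>e\<in>directions. \<integral>U. F (case_nat e U) \<partial>driver_law) / (2 * CARD('d))"
proof -
  interpret S: prob_space "driver_law :: (nat \<Rightarrow> int ^ 'd) measure" by (rule prob_space_driver_law)
  interpret DS: pair_prob_space "direction_law :: (int ^ 'd) measure" "driver_law :: (nat \<Rightarrow> int ^ 'd) measure" ..
  have "(\<integral>U. F U \<partial>driver_law) = (\<integral>p. F (case p of (e, U) \<Rightarrow> case_nat e U) \<partial>(direction_law \<Otimes>\<^sub>M driver_law))"
    by (subst distr_driver[symmetric], rule integral_distr) measurable
  also have "\<dots> = (\<integral>e. \<integral>U. F (case_nat e U) \<partial>driver_law \<partial>direction_law)"
    by (subst DS.integral_fst'[symmetric])
      (auto intro!: DS.P.integrable_const_bound[of _ B] simp: bd)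
  finally show ?thesis
    by (simp add: integral_pmf_of_set card_directions)
qed

section \<open>The skew product and the walk along its orbits\<close>

definition step :: "'d::finite config \<times> (nat \<Rightarrow> int ^ 'd) \<Rightarrow> 'd config \<times> (nat \<Rightarrow> int ^ 'd)" where
  "step z = (jump (snd z 0) (fst z), \<lambda>n. snd z (Suc n))"

definition increment :: "'d::finite config \<times> (nat \<Rightarrow> int ^ 'd) \<Rightarrow> int ^ 'd" where
  "increment z = int (gap (snd z 0) (fst z)) *s snd z 0"

definition walk :: "'d::finite config \<times> (nat \<Rightarrow> int ^ 'd) \<Rightarrow> nat \<Rightarrow> int ^ 'd" where
  "walk z n = (\<Sum>k<n. increment ((step ^^ k) z))"

lemma walk_0 [simp]: "walk z 0 = 0"
  by (simp add: walk_def)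

lemma walk_Suc: "walk z (Suc n) = increment z + walk (step z) n"
  unfolding walk_def by (simp only: sum.lessThan_Suc_shift) (simp add: funpow_swap1)

lemma measurable_gap_driver [measurable]:
  "(\<lambda>z. gap (snd z 0) (fst z)) \<in> measurable (config_space \<Otimes>\<^sub>M driver_law) (count_space UNIV)"
  by (rule measurable_compose_countable[of "\<lambda>e z. gap e (fst z)"]) measurable

lemma measurable_step [measurable]:
  "(step :: 'd::finite config \<times> _ \<Rightarrow> _) \<in> measurable (config_space \<Otimes>\<^sub>M driver_law) (config_space \<Otimes>\<^sub>M driver_law)"
proof -
  have "(\<lambda>z :: 'd config \<times> _. jump (snd z 0) (fst z)) \<in> measurable (config_space \<Otimes>\<^sub>M driver_law) config_space"
  proof (rule measurable_compose_countable[of "\<lambda>e z. jump e (fst z)" _ _ "\<lambda>z. snd z 0"])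
    show "(\<lambda>z. jump e (fst z)) \<in> measurable (config_space \<Otimes>\<^sub>M driver_law) config_space" for e :: "int ^ 'd"
      by (rule measurable_compose[OF measurable_fst measurable_jump])
    show "(\<lambda>z. snd z 0) \<in> measurable (config_space \<Otimes>\<^sub>M driver_law) (count_space UNIV)"
      by (rule measurable_compose[OF measurable_snd measurable_driver])
  qed
  moreover have "(\<lambda>z n. snd z (Suc n)) \<in> measurable (config_space \<Otimes>\<^sub>M driver_law) driver_law"
    by (rule measurable_into_driver) measurable
  ultimately show ?thesis unfolding step_def[abs_def] by (rule measurable_Pair)
qed

lemma measurable_funpow_step [measurable]:
  "step ^^ k \<in> measurable (config_space \<Otimes>\<^sub>M driver_law) (config_space \<Otimes>\<^sub>M driver_law)"
proof (induction k)
  case (Suc k)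
  then show ?case using measurable_comp[OF Suc measurable_step] by simp
qed (simp add: id_def)

lemma measurable_increment [measurable]:
  "increment \<in> measurable (config_space \<Otimes>\<^sub>M driver_law) (count_space UNIV)"
  unfolding increment_def[abs_def]
  by (rule measurable_compose_countable[of "\<lambda>e z. int (gap (snd z 0) (fst z)) *s e"]) measurable

lemma measurable_walk [measurable]:
  "(\<lambda>z :: 'd::finite config \<times> _. walk z n) \<in> measurable (config_space \<Otimes>\<^sub>M driver_law) (count_space UNIV)"
proof (induction n)
  case (Suc n)
  note [measurable] = Suc
  have "(\<lambda>z :: 'd config \<times> _. increment z + walk (step z) n) \<in> measurable (config_space \<Otimes>\<^sub>M driver_law) (count_space UNIV)"
  proof (rule measurable_compose_countable[of "\<lambda>x z. x + walk (step z) n", OF _ measurable_increment])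
    show "(\<lambda>z. x + walk (step z) n) \<in> measurable (config_space \<Otimes>\<^sub>M driver_law) (count_space UNIV)"
      for x :: "int ^ 'd"
      by (rule measurable_compose[OF measurable_compose[OF measurable_step Suc], where g="\<lambda>y. x + y"]) simp
  qed
  then show ?case by (simp add: walk_Suc)
qed simp

lemma measurable_walk_section [measurable]:
  "(\<lambda>U. walk (\<omega>, U) n) \<in> measurable driver_law (count_space UNIV)"
  by (rule measurable_compose[OF measurable_Pair1' measurable_walk]) simp

lemma Collect_driver_sets:
  "Measurable.pred driver_law R \<Longrightarrow> {U. R U} \<in> sets driver_law"
  by (simp add: pred_def)

lemma emeasure_driver:
  fixes R :: "(nat \<Rightarrow> int ^ 'd::finite) \<Rightarrow> bool"
  assumes [measurable]: "Measurable.pred driver_law R"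
  shows "emeasure driver_law {U. R U} =
    (\<Sum>e\<in>directions. emeasure driver_law {U. R (case_nat e U)}) / of_nat (2 * CARD('d))"
proof -
  have "{U. R U} \<in> sets driver_law"
    by (rule Collect_driver_sets[OF assms])
  moreover have "{U. R (case_nat e U)} \<in> sets driver_law" for e
    by (rule Collect_driver_sets[OF measurable_compose[OF measurable_case_nat_driver assms]])
  ultimately show ?thesis
    using nn_integral_driver[of "indicator {U. R U}"]
    by (simp add: nn_integral_indicator vimage_def flip: indicator_vimage)
qed

text \<open>Conditioning on the first direction turns the walk from \<open>v\<close> into a walk
  from a neighbor of \<open>v\<close>, driven by the remaining directions. The starting point
  therefore has to vary in the induction, with \<open>shift v\<close> keeping the walker at the
  origin of its environment.\<close>

lemma emeasure_walk_cylinder: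
  fixes \<omega> :: "'d::finite config"
  assumes gaps: "\<And>v e. \<omega> v \<Longrightarrow> e \<in> directions \<Longrightarrow> \<exists>k>0. \<omega> (v + int k *s e)"
  shows "\<omega> v \<Longrightarrow> emeasure driver_law {U. \<forall>i\<le>n. v + walk (shift v \<omega>, U) i = s i} =
    ennreal (indicator {v} (s 0) * (\<Prod>i<n. pmf (pmf_of_set (neighbors \<omega> (s i))) (s (Suc i))))"
proof (induction n arbitrary: v s)
  case 0
  interpret S: prob_space "driver_law :: (nat \<Rightarrow> int ^ 'd) measure" by (rule prob_space_driver_law)
  show ?case using S.emeasure_space_1 by (auto simp: indicator_def)
next
  case (Suc n)
  show ?case
  proof (cases "s 0 = v")
    case False
    then have empty: "{U. \<forall>i\<le>Suc n. v + walk (shift v \<omega>, U) i = s i} = {}" by auto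
    show ?thesis unfolding empty using False by simp
  next
    case True
    define w where "w e = v + int (gap e (shift v \<omega>)) *s e" for e
    let ?N = "2 * CARD('d)"
    let ?p = "\<Prod>i<n. pmf (pmf_of_set (neighbors \<omega> (s (Suc i)))) (s (Suc (Suc i)))"
    have nb: "neighbors \<omega> v = w ` directions" by (simp add: neighbors_def w_def[abs_def])
    have card: "card (neighbors \<omega> v) = ?N" by (rule card_neighbors) (use gaps Suc in auto)
    \<comment> \<open>There are as many neighbors as directions, so no two directions share a
      neighbor.\<close>
    then have inj: "inj_on w directions"
      by (intro eq_card_imp_inj_on) (simp_all add: nb card_directions)
    have w: "\<omega> (w e)" if "e \<in> directions" for e
      using site_gap[of "shift v \<omega>" e] gaps[OF Suc.prems that] by (simp add: w_def shift_apply)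
    have walk: "v + walk (shift v \<omega>, case_nat e U) (Suc i) = w e + walk (shift (w e) \<omega>, U) i" for e U i
      by (simp add: walk_Suc step_def increment_def w_def jump_def add.assoc)
    have "(\<forall>i\<le>Suc n. v + walk (shift v \<omega>, case_nat e U) i = s i)
        \<longleftrightarrow> (\<forall>i\<le>n. w e + walk (shift (w e) \<omega>, U) i = s (Suc i))" for e U
      using True All_less_Suc2[of "Suc n"] by (simp add: walk flip: less_Suc_eq_le)
    then have "emeasure driver_law {U. \<forall>i\<le>Suc n. v + walk (shift v \<omega>, U) i = s i} =
      (\<Sum>e\<in>directions. emeasure driver_law {U. \<forall>i\<le>n. w e + walk (shift (w e) \<omega>, U) i = s (Suc i)}) / of_nat ?N"
      by (subst emeasure_driver) simp_all
    also have "\<dots> = (\<Sum>e\<in>directions. ennreal (indicator {w e} (s 1) * ?p)) / of_nat ?N"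
      using Suc.IH w by simp
    also have "\<dots> = ennreal ((\<Sum>e\<in>directions. indicator {w e} (s 1) * ?p) / ?N)"
      by (subst sum_ennreal) (auto simp: prod_nonneg sum_nonneg divide_ennreal ennreal_of_nat_eq_real_of_nat simp del: of_nat_mult)
    also have "(\<Sum>e\<in>directions. indicator {w e} (s 1) * ?p) = indicator (neighbors \<omega> v) (s 1) * ?p"
    proof -
      have "(\<Sum>e\<in>directions. indicator {w e} (s 1) :: real) = (\<Sum>u\<in>neighbors \<omega> v. indicator {u} (s 1))"
        unfolding nb by (simp add: sum.reindex[OF inj])
      also have "\<dots> = indicator (neighbors \<omega> v) (s 1)"
        by (auto simp: indicator_def sum.delta)
      finally show ?thesis by (simp flip: sum_distrib_right)
    qed
    also have "indicator (neighbors \<omega> v) (s 1) * ?p / ?N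
        = indicator {v} (s 0) * (\<Prod>i<Suc n. pmf (pmf_of_set (neighbors \<omega> (s i))) (s (Suc i)))"
      unfolding prod.lessThan_Suc_shift using True by (simp add: card)
    finally show ?thesis .
  qed
qed

text \<open>Cylinders generate the trajectory space and are stable under intersection, and both laws
  give them the same product of transition probabilities.\<close>

lemma distr_walk:
  fixes \<omega> :: "'d::finite config"
  assumes "\<And>v e. \<omega> v \<Longrightarrow> e \<in> directions \<Longrightarrow> \<exists>k>0. \<omega> (v + int k *s e)" and "\<omega> 0"
  shows "distr driver_law (\<Pi>\<^sub>M n\<in>UNIV. count_space UNIV) (\<lambda>U. walk (\<omega>, U)) = quenched_law \<omega>"
    (is "distr _ ?T _ = _")
proof (rule measure_eqI_generator_eq_countable[where \<Omega>=UNIV, OF Int_stable_cylinders])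
  let ?E = "insert {} (range (\<lambda>(n::nat, s::nat \<Rightarrow> int ^ 'd). {x. \<forall>i\<le>n. x i = s i}))"
  interpret S: prob_space "driver_law :: (nat \<Rightarrow> int ^ 'd) measure" by (rule prob_space_driver_law)
  have [measurable]: "(\<lambda>U. walk (\<omega>, U)) \<in> measurable driver_law ?T"
    by (rule measurable_PiM_single') (auto simp: space_PiM)
  show "sets (distr driver_law ?T (\<lambda>U. walk (\<omega>, U))) = sigma_sets UNIV ?E"
    by (simp add: sets_trajectories)
  show "sets (quenched_law \<omega>) = sigma_sets UNIV ?E"
    by (simp add: quenched_law_def sets_trajectories)
  have cyl: "emeasure (distr driver_law ?T (\<lambda>U. walk (\<omega>, U))) {x. \<forall>i\<le>n. x i = s i} =
      emeasure (quenched_law \<omega>) {x. \<forall>i\<le>n. x i = s i}" for n s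
  proof -
    have "{x. \<forall>i\<le>n. x i = s i} \<in> sets ?T"
      unfolding sets_trajectories by (rule sigma_sets.Basic) auto
    then have "emeasure (distr driver_law ?T (\<lambda>U. walk (\<omega>, U))) {x. \<forall>i\<le>n. x i = s i} =
      emeasure driver_law {U. \<forall>i\<le>n. 0 + walk (shift 0 \<omega>, U) i = s i}"
      by (subst emeasure_distr) (simp_all add: vimage_def)
    also have "\<dots> = emeasure (quenched_law \<omega>) {x. \<forall>i\<le>n. x i = s i}"
      unfolding quenched_law_def emeasure_markov_law_cylinder
      by (rule emeasure_walk_cylinder[OF assms])
    finally show ?thesis .
  qed
  fix X assume "X \<in> ?E"
  then show "emeasure (distr driver_law ?T (\<lambda>U. walk (\<omega>, U))) X = emeasure (quenched_law \<omega>) X"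
  proof (elim insertE rangeE)
    fix p assume "X = (case p of (n, s) \<Rightarrow> {x. \<forall>i\<le>n. x i = s i})"
    then have "X = {x. \<forall>i\<le>fst p. x i = snd p i}" by (simp only: case_prod_unfold)
    then show ?thesis by (simp only: cyl)
  qed simp
next
  \<comment> \<open>The cylinders that fix only the position at time 0 form the countable cover by
    sets of finite measure needed for uniqueness of the extension.\<close>
  let ?A = "range (\<lambda>v::int ^ 'd. {x. \<forall>i\<le>(0::nat). x i = v})"
  show "?A \<subseteq> insert {} (range (\<lambda>(n::nat, s::nat \<Rightarrow> int ^ 'd). {x. \<forall>i\<le>n. x i = s i}))"
    by (auto intro!: image_eqI[of _ _ "(0, \<lambda>_. _)"])
  show "\<Union>?A = UNIV" by auto
  show "countable ?A" by simp
  interpret S: prob_space "distr driver_law ?T (\<lambda>U. walk (\<omega>, U))"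
    by (rule prob_space.prob_space_distr[OF prob_space_driver_law])
      (rule measurable_PiM_single', auto simp: space_PiM)
  show "emeasure (distr driver_law ?T (\<lambda>U. walk (\<omega>, U))) a \<noteq> \<infinity>" for a
    by simp
qed (auto simp: sets_trajectories quenched_law_def)

section \<open>Reversible averaging and second moments\<close>

lemma uminus_directions [simp]: "- e \<in> directions \<longleftrightarrow> e \<in> directions"
proof -
  have "- e \<in> directions" if "e \<in> directions" for e :: "int ^ 'a"
    using that by (auto simp: directions_def)
  from this[of e] this[of "- e"] show ?thesis by auto
qed

lemma sum_directions_uminus: "(\<Sum>e\<in>directions. f (- e)) = (\<Sum>e\<in>directions. f e)"
  by (rule sum.reindex_bij_witness[of _ uminus uminus]) auto

lemma abs_mult_bound: "\<bar>a\<bar> \<le> A \<Longrightarrow> \<bar>b\<bar> \<le> B \<Longrightarrow> \<bar>a * b\<bar> \<le> A * (B::real)"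
  by (simp add: abs_mult mult_mono')

text \<open>The operator \<open>R\<close>: the transition operator of the environment seen from the
  walk.\<close>

definition jump_avg :: "('d::finite config \<Rightarrow> real) \<Rightarrow> 'd config \<Rightarrow> real" where
  "jump_avg \<phi> \<omega> = (\<Sum>e\<in>directions. \<phi> (jump e \<omega>)) / (2 * CARD('d))"

text \<open>The conditional mean \<open>a\<close> of the first score given the environment.\<close>

definition drift :: "(int ^ 'd \<Rightarrow> nat \<Rightarrow> real) \<Rightarrow> 'd::finite config \<Rightarrow> real" where
  "drift c \<omega> = (\<Sum>e\<in>directions. c e (gap e \<omega>)) / (2 * CARD('d))"

lemma average_bound:
  fixes f :: "int ^ 'd::finite \<Rightarrow> real"
  assumes "\<And>e. \<bar>f e\<bar> \<le> B"
  shows "\<bar>(\<Sum>e\<in>directions. f e) / (2 * CARD('d))\<bar> \<le> B"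
proof -
  have "\<bar>\<Sum>e\<in>directions. f e\<bar> \<le> (\<Sum>e\<in>(directions :: (int ^ 'd) set). B)"
    by (rule order_trans[OF sum_abs]) (intro sum_mono assms)
  then show ?thesis by (simp add: card_directions field_simps)
qed

lemma measurable_jump_avg [measurable]:
  assumes [measurable]: "\<phi> \<in> borel_measurable config_space"
  shows "jump_avg \<phi> \<in> borel_measurable config_space"
  unfolding jump_avg_def[abs_def] by measurable

lemma measurable_drift [measurable]: "drift c \<in> borel_measurable config_space"
  unfolding drift_def[abs_def] by measurable

lemma jump_avg_bound: "(\<And>\<omega>. \<bar>\<phi> \<omega>\<bar> \<le> B) \<Longrightarrow> \<bar>jump_avg \<phi> \<omega>\<bar> \<le> B"
  unfolding jump_avg_def by (rule average_bound)

lemma drift_bound: "(\<And>e k. \<bar>c e k\<bar> \<le> B) \<Longrightarrow> \<bar>drift c \<omega>\<bar> \<le> B"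
  unfolding drift_def by (rule average_bound)

lemma measurable_funpow_jump_avg [measurable]:
  "(jump_avg ^^ m) (drift c) \<in> borel_measurable config_space"
  by (induction m) simp_all

lemma funpow_jump_avg_bound:
  "(\<And>e k. \<bar>c e k\<bar> \<le> B) \<Longrightarrow> \<bar>(jump_avg ^^ m) (drift c) \<omega>\<bar> \<le> B"
  by (induction m arbitrary: \<omega>) (simp_all add: drift_bound jump_avg_bound)

text \<open>A general weight \<open>c\<close> on direction and gap length treats the truncated
  coordinates, the discarded tails and the gap itself alike.\<close>

definition score :: "(int ^ 'd \<Rightarrow> nat \<Rightarrow> real) \<Rightarrow> 'd::finite config \<times> (nat \<Rightarrow> int ^ 'd) \<Rightarrow> real" where
  "score c z = c (snd z 0) (gap (snd z 0) (fst z))"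

lemma measurable_score [measurable]:
  "score c \<in> borel_measurable (config_space \<Otimes>\<^sub>M driver_law)"
  unfolding score_def[abs_def]
  by (rule measurable_compose_countable[of "\<lambda>e z. c e (gap (snd z 0) (fst z))"]) measurable

lemma measurable_section:
  fixes f :: "'d::finite config \<times> (nat \<Rightarrow> int ^ 'd) \<Rightarrow> 'b"
  shows "f \<in> measurable (config_space \<Otimes>\<^sub>M driver_law) N \<Longrightarrow> (\<lambda>U. f (\<omega>, U)) \<in> measurable driver_law N"
  by (rule measurable_compose[OF measurable_Pair1']) simp_all

lemma step_case_nat: "step (\<omega>, case_nat e U) = (jump e \<omega>, U)"
  by (simp add: step_def)

lemma funpow_Suc_apply: "(f ^^ Suc n) x = (f ^^ n) (f x)"
  by (simp add: funpow_swap1)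

text \<open>Markov property: integrating out the first direction moves the environment by one jump
  and thereby applies \<open>jump_avg\<close> once.\<close>

lemma integral_score_funpow:
  fixes \<omega> :: "'d::finite config"
  assumes bd: "\<And>e k. \<bar>c e k\<bar> \<le> B"
  shows "(\<integral>U. score c ((step ^^ m) (\<omega>, U)) \<partial>driver_law) = (jump_avg ^^ m) (drift c) \<omega>"
proof (induction m arbitrary: \<omega>)
  case 0
  interpret S: prob_space "driver_law :: (nat \<Rightarrow> int ^ 'd) measure" by (rule prob_space_driver_law)
  have "(\<integral>U. score c (\<omega>, U) \<partial>driver_law) =
      (\<Sum>e\<in>directions. \<integral>U. score c (\<omega>, case_nat e U) \<partial>driver_law) / (2 * CARD('d))"
    by (rule integral_driver[OF measurable_section[OF measurable_score], where B=B]) (simp add: score_def bd)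
  also have "\<dots> = drift c \<omega>"
    by (simp add: score_def drift_def S.prob_space[unfolded space_driver_law])
  finally show ?case by simp
next
  case (Suc m)
  have "(\<lambda>z. score c ((step ^^ Suc m) z)) \<in> borel_measurable (config_space \<Otimes>\<^sub>M driver_law)"
    by (rule measurable_compose[OF measurable_funpow_step measurable_score])
  then have "(\<integral>U. score c ((step ^^ Suc m) (\<omega>, U)) \<partial>driver_law) =
      (\<Sum>e\<in>directions. \<integral>U. score c ((step ^^ Suc m) (\<omega>, case_nat e U)) \<partial>driver_law) / (2 * CARD('d))"
    by (intro integral_driver[where B=B] measurable_section[where f="\<lambda>z. score c ((step ^^ Suc m) z)"])
      (simp_all add: score_def bd del: funpow.simps)
  also have "\<dots> = jump_avg ((jump_avg ^^ m) (drift c)) \<omega>"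
    by (simp only: funpow_Suc_apply step_case_nat Suc.IH jump_avg_def[of "(jump_avg ^^ m) (drift c)"])
  finally show ?case by simp
qed

section \<open>Invariance under the skew product and the spectral bound for the averaging
  operator\<close>

context stationary_points
begin

sublocale palm: prob_space "palm Q" by (rule prob_space_palm)

sublocale drivers: prob_space "driver_law :: (nat \<Rightarrow> int ^ 'd) measure" by (rule prob_space_driver_law)

sublocale joint: pair_prob_space "palm Q" "driver_law :: (nat \<Rightarrow> int ^ 'd) measure" ..

abbreviation joint_law :: "('d config \<times> (nat \<Rightarrow> int ^ 'd)) measure" where
  "joint_law \<equiv> palm Q \<Otimes>\<^sub>M driver_law"

lemma sets_joint_law [measurable_cong]: "sets joint_law = sets (config_space \<Otimes>\<^sub>M driver_law)"
  by (intro sets_pair_measure_cong) simp_all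

lemma measurable_joint_law: "measurable joint_law N = measurable (config_space \<Otimes>\<^sub>M driver_law) N"
  by (intro measurable_cong_sets sets_joint_law refl)

lemma integral_reversal:
  fixes F :: "nat \<times> 'd config \<times> 'd config \<Rightarrow> real"
  assumes [measurable]: "F \<in> borel_measurable (count_space UNIV \<Otimes>\<^sub>M (config_space \<Otimes>\<^sub>M config_space))"
  shows "(\<integral>\<omega>. F (gap e \<omega>, \<omega>, jump e \<omega>) \<partial>palm Q) = (\<integral>\<omega>. F (gap (- e) \<omega>, jump (- e) \<omega>, \<omega>) \<partial>palm Q)"
proof -
  let ?N = "count_space UNIV \<Otimes>\<^sub>M (config_space \<Otimes>\<^sub>M config_space) :: (nat \<times> 'd config \<times> 'd config) measure"
  have "(\<integral>\<omega>. F (gap e \<omega>, \<omega>, jump e \<omega>) \<partial>palm Q) = (\<integral>x. F x \<partial>distr (palm Q) ?N (\<lambda>\<omega>. (gap e \<omega>, \<omega>, jump e \<omega>)))"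
    by (rule integral_distr[symmetric]) measurable
  also have "\<dots> = (\<integral>\<omega>. F (gap (- e) \<omega>, jump (- e) \<omega>, \<omega>) \<partial>palm Q)"
    unfolding distr_reversal by (rule integral_distr) measurable
  finally show ?thesis .
qed

text \<open>The last component of the triples in \<open>distr_reversal\<close> is the end of the
  jump on one side and the configuration itself on the other.\<close>

lemma distr_jump: "distr (palm Q) (palm Q) (jump e) = palm Q"
proof -
  let ?N = "count_space UNIV \<Otimes>\<^sub>M (config_space \<Otimes>\<^sub>M config_space) :: (nat \<times> 'd config \<times> 'd config) measure"
  have p: "(\<lambda>x. snd (snd x)) \<in> measurable ?N (palm Q)" by measurable
  have "distr (palm Q) (palm Q) (jump e) =
      distr (distr (palm Q) ?N (\<lambda>\<omega>. (gap e \<omega>, \<omega>, jump e \<omega>))) (palm Q) (\<lambda>x. snd (snd x))"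
    by (subst distr_distr[OF p]) (measurable, simp add: comp_def)
  also have "\<dots> = distr (palm Q) (palm Q) (\<lambda>\<omega>. \<omega>)"
    unfolding distr_reversal by (subst distr_distr[OF p]) (measurable, simp add: comp_def)
  also have "\<dots> = palm Q" by (rule distr_id)
  finally show ?thesis .
qed

lemma integral_jump:
  fixes \<phi> :: "'d config \<Rightarrow> real"
  assumes "\<phi> \<in> borel_measurable config_space"
  shows "(\<integral>\<omega>. \<phi> (jump e \<omega>) \<partial>palm Q) = (\<integral>\<omega>. \<phi> \<omega> \<partial>palm Q)"
proof -
  have "(\<integral>\<omega>. \<phi> \<omega> \<partial>distr (palm Q) (palm Q) (jump e)) = (\<integral>\<omega>. \<phi> (jump e \<omega>) \<partial>palm Q)"
    using assms by (intro integral_distr) measurable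
  then show ?thesis by (simp add: distr_jump)
qed

lemma nn_integral_jump:
  assumes "\<phi> \<in> borel_measurable config_space"
  shows "(\<integral>\<^sup>+\<omega>. \<phi> (jump e \<omega>) \<partial>palm Q) = (\<integral>\<^sup>+\<omega>. \<phi> \<omega> \<partial>palm Q)"
proof -
  have "(\<integral>\<^sup>+\<omega>. \<phi> \<omega> \<partial>distr (palm Q) (palm Q) (jump e)) = (\<integral>\<^sup>+\<omega>. \<phi> (jump e \<omega>) \<partial>palm Q)"
    using assms by (intro nn_integral_distr) measurable
  then show ?thesis by (simp add: distr_jump)
qed

text \<open>Once the first direction is integrated out, the remaining directions have their original
  law, and each single \<open>jump e\<close> preserves the Palm measure; so does the average over
  \<open>e\<close>.\<close>

lemma distr_step: "distr joint_law joint_law step = joint_law"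
proof (rule measure_eqI)
  fix A assume "A \<in> sets (distr joint_law joint_law step)"
  then have A: "A \<in> sets joint_law" "A \<in> sets (config_space \<Otimes>\<^sub>M driver_law)"
    by (simp_all add: sets_joint_law)
  have st: "step \<in> measurable joint_law joint_law" by measurable
  have sp: "space joint_law = UNIV" by (simp add: space_pair_measure)
  have sA: "step -` A \<in> sets joint_law"
    using measurable_sets[OF st A(1)] by (simp add: sp)
  define \<phi> where "\<phi> \<omega> = emeasure driver_law (Pair \<omega> -` A)" for \<omega>
  have \<phi>: "\<phi> \<in> borel_measurable config_space"
    unfolding \<phi>_def by (rule drivers.measurable_emeasure_Pair) (rule A)
  note [measurable] = \<phi>
  have "emeasure driver_law (Pair \<omega> -` step -` A) = (\<Sum>e\<in>directions. \<phi> (jump e \<omega>)) / of_nat (2 * CARD('d))" for \<omega>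
  proof -
    have "Measurable.pred driver_law (\<lambda>U. step (\<omega>, U) \<in> A)"
      using A(2) measurable_section[OF measurable_step, of \<omega>] by (rule pred_sets2)
    then have "emeasure driver_law {U. step (\<omega>, U) \<in> A} =
        (\<Sum>e\<in>directions. emeasure driver_law {U. step (\<omega>, case_nat e U) \<in> A}) / of_nat (2 * CARD('d))"
      by (rule emeasure_driver)
    then show ?thesis by (simp only: step_case_nat \<phi>_def vimage_def mem_Collect_eq)
  qed
  then have "emeasure (distr joint_law joint_law step) A =
      (\<integral>\<^sup>+\<omega>. (\<Sum>e\<in>directions. \<phi> (jump e \<omega>)) / of_nat (2 * CARD('d)) \<partial>palm Q)"
    using sA by (simp add: emeasure_distr[OF st A(1)] sp drivers.emeasure_pair_measure_alt)
  also have "\<dots> = (\<Sum>e\<in>(directions :: (int ^ 'd) set). \<integral>\<^sup>+\<omega>. \<phi> \<omega> \<partial>palm Q) / of_nat (2 * CARD('d))"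
    by (subst nn_integral_divide, measurable, subst nn_integral_sum, measurable)
      (simp only: nn_integral_jump[OF \<phi>])
  also have "\<dots> = (\<integral>\<^sup>+\<omega>. \<phi> \<omega> \<partial>palm Q)"
    by (simp add: card_directions mult.commute[of "2 * of_nat CARD('d)"] ennreal_mult_divide_eq ennreal_of_nat_neq_top ennreal_mult_eq_top_iff)
  also have "\<dots> = emeasure joint_law A"
    using A(1) by (simp add: \<phi>_def drivers.emeasure_pair_measure_alt)
  finally show "emeasure (distr joint_law joint_law step) A = emeasure joint_law A" .
qed simp

lemma integrable_bounded:
  fixes f :: "'d config \<Rightarrow> real"
  shows "f \<in> borel_measurable config_space \<Longrightarrow> (\<And>\<omega>. \<bar>f \<omega>\<bar> \<le> B) \<Longrightarrow> integrable (palm Q) f"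
  by (rule palm.integrable_const_bound[of _ B]) (simp_all cong: measurable_cong_sets)

lemma integral_average:
  fixes f :: "int ^ 'd \<Rightarrow> 'd config \<Rightarrow> real"
  assumes "\<And>e. f e \<in> borel_measurable config_space" "\<And>e \<omega>. \<bar>f e \<omega>\<bar> \<le> B"
  shows "(\<integral>\<omega>. (\<Sum>e\<in>directions. f e \<omega>) / (2 * CARD('d)) \<partial>palm Q) =
    (\<Sum>e\<in>directions. \<integral>\<omega>. f e \<omega> \<partial>palm Q) / (2 * CARD('d))"
  using integrable_bounded[OF assms] by simp

text \<open>Reversal carries the jump along \<open>e\<close> from one factor to a jump along
  \<open>- e\<close> in the other, and the set of directions is symmetric.\<close>

lemma jump_avg_symmetric:
  fixes \<phi> \<psi> :: "'d config \<Rightarrow> real"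
  assumes [measurable]: "\<phi> \<in> borel_measurable config_space" "\<psi> \<in> borel_measurable config_space"
    and bd: "\<And>\<omega>. \<bar>\<phi> \<omega>\<bar> \<le> A" "\<And>\<omega>. \<bar>\<psi> \<omega>\<bar> \<le> B"
  shows "(\<integral>\<omega>. jump_avg \<phi> \<omega> * \<psi> \<omega> \<partial>palm Q) = (\<integral>\<omega>. \<phi> \<omega> * jump_avg \<psi> \<omega> \<partial>palm Q)"
proof -
  have "(\<integral>\<omega>. jump_avg \<phi> \<omega> * \<psi> \<omega> \<partial>palm Q) = (\<integral>\<omega>. (\<Sum>e\<in>directions. \<phi> (jump e \<omega>) * \<psi> \<omega>) / (2 * CARD('d)) \<partial>palm Q)"
    by (simp add: jump_avg_def sum_distrib_right)
  also have "\<dots> = (\<Sum>e\<in>directions. \<integral>\<omega>. \<phi> (jump e \<omega>) * \<psi> \<omega> \<partial>palm Q) / (2 * CARD('d))"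
    by (rule integral_average[OF _ abs_mult_bound[OF bd]]) measurable
  also have "(\<Sum>e\<in>directions. \<integral>\<omega>. \<phi> (jump e \<omega>) * \<psi> \<omega> \<partial>palm Q) =
      (\<Sum>e\<in>directions. \<integral>\<omega>. \<phi> \<omega> * \<psi> (jump (- e) \<omega>) \<partial>palm Q)"
    using integral_reversal[of "\<lambda>(k, \<omega>, \<omega>'). \<phi> \<omega>' * \<psi> \<omega>"] by simp
  also have "\<dots> = (\<Sum>e\<in>directions. \<integral>\<omega>. \<phi> \<omega> * \<psi> (jump e \<omega>) \<partial>palm Q)"
    by (rule sum_directions_uminus)
  also have "\<dots> / (2 * CARD('d)) = (\<integral>\<omega>. (\<Sum>e\<in>directions. \<phi> \<omega> * \<psi> (jump e \<omega>)) / (2 * CARD('d)) \<partial>palm Q)"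
    by (rule integral_average[OF _ abs_mult_bound[OF bd], symmetric]) measurable
  finally show ?thesis by (simp add: jump_avg_def sum_distrib_left)
qed

text \<open>The bound \<open>R \<ge> -1\<close> comes from integrating the square of
  \<open>\<phi> \<omega> + \<phi> (jump e \<omega>)\<close>, whose two pure terms have equal
  integrals by invariance, and averaging over \<open>e\<close>.\<close>

lemma jump_avg_lower:
  fixes \<phi> :: "'d config \<Rightarrow> real"
  assumes [measurable]: "\<phi> \<in> borel_measurable config_space" and bd: "\<And>\<omega>. \<bar>\<phi> \<omega>\<bar> \<le> B"
  shows "- (\<integral>\<omega>. \<phi> \<omega> * \<phi> \<omega> \<partial>palm Q) \<le> (\<integral>\<omega>. \<phi> \<omega> * jump_avg \<phi> \<omega> \<partial>palm Q)"
proof -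
  have [simp]: "integrable (palm Q) (\<lambda>\<omega>. \<phi> \<omega> * \<phi> \<omega>)" "integrable (palm Q) (\<lambda>\<omega>. \<phi> (jump e \<omega>) * \<phi> (jump e \<omega>))"
      "integrable (palm Q) (\<lambda>\<omega>. \<phi> \<omega> * \<phi> (jump e \<omega>))" for e
  proof -
    note I = integrable_bounded[OF _ abs_mult_bound[OF bd bd]]
    show "integrable (palm Q) (\<lambda>\<omega>. \<phi> \<omega> * \<phi> \<omega>)" by (rule I) measurable
    show "integrable (palm Q) (\<lambda>\<omega>. \<phi> (jump e \<omega>) * \<phi> (jump e \<omega>))" by (rule I) measurable
    show "integrable (palm Q) (\<lambda>\<omega>. \<phi> \<omega> * \<phi> (jump e \<omega>))" by (rule I) measurable
  qed
  have "- (\<integral>\<omega>. \<phi> \<omega> * \<phi> \<omega> \<partial>palm Q) \<le> (\<integral>\<omega>. \<phi> \<omega> * \<phi> (jump e \<omega>) \<partial>palm Q)" for e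
  proof -
    have "- (\<integral>\<omega>. \<phi> \<omega> * \<phi> \<omega> \<partial>palm Q) = (\<integral>\<omega>. - (\<phi> \<omega> * \<phi> \<omega> + \<phi> (jump e \<omega>) * \<phi> (jump e \<omega>)) / 2 \<partial>palm Q)"
      using integral_jump[of "\<lambda>\<omega>. \<phi> \<omega> * \<phi> \<omega>" e] by simp
    also have "\<dots> \<le> (\<integral>\<omega>. \<phi> \<omega> * \<phi> (jump e \<omega>) \<partial>palm Q)"
    proof (rule integral_mono)
      fix \<omega> show "- (\<phi> \<omega> * \<phi> \<omega> + \<phi> (jump e \<omega>) * \<phi> (jump e \<omega>)) / 2 \<le> \<phi> \<omega> * \<phi> (jump e \<omega>)"
        using zero_le_square[of "\<phi> \<omega> + \<phi> (jump e \<omega>)"] by (simp add: algebra_simps)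
    qed simp_all
    finally show ?thesis .
  qed
  then have "(\<Sum>e\<in>(directions :: (int ^ 'd) set). - (\<integral>\<omega>. \<phi> \<omega> * \<phi> \<omega> \<partial>palm Q)) / (2 * CARD('d))
      \<le> (\<Sum>e\<in>directions. \<integral>\<omega>. \<phi> \<omega> * \<phi> (jump e \<omega>) \<partial>palm Q) / (2 * CARD('d))"
    by (intro divide_right_mono sum_mono) auto
  also have "\<dots> = (\<integral>\<omega>. (\<Sum>e\<in>directions. \<phi> \<omega> * \<phi> (jump e \<omega>)) / (2 * CARD('d)) \<partial>palm Q)"
    by (rule integral_average[OF _ abs_mult_bound[OF bd bd], symmetric]) measurable
  finally show ?thesis by (simp add: card_directions jump_avg_def sum_distrib_left)
qed

end

section \<open>Accumulated scores and truncation\<close>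

lemma measurable_score_step [measurable]:
  "(\<lambda>z. score c ((step ^^ m) z)) \<in> borel_measurable (config_space \<Otimes>\<^sub>M driver_law)"
  by (rule measurable_compose[OF measurable_funpow_step measurable_score])

definition total_score :: "(int ^ 'd \<Rightarrow> nat \<Rightarrow> real) \<Rightarrow> nat \<Rightarrow> 'd::finite config \<times> (nat \<Rightarrow> int ^ 'd) \<Rightarrow> real" where
  "total_score c n z = (\<Sum>k<n. score c ((step ^^ k) z))"

lemma measurable_total_score [measurable]:
  "total_score c n \<in> borel_measurable (config_space \<Otimes>\<^sub>M driver_law)"
  unfolding total_score_def[abs_def] by (intro borel_measurable_sum measurable_score_step)

lemma total_score_bound:
  assumes "\<And>e k. \<bar>c e k\<bar> \<le> B"
  shows "\<bar>total_score c n z\<bar> \<le> real n * B"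
proof -
  have "\<bar>total_score c n z\<bar> \<le> (\<Sum>k<n. B)"
    unfolding total_score_def score_def by (rule order_trans[OF sum_abs]) (intro sum_mono assms)
  then show ?thesis by simp
qed

definition large :: "nat \<Rightarrow> int ^ 'd::finite \<Rightarrow> nat \<Rightarrow> real" where
  "large M e k = (if k \<le> M then 0 else real k)"

text \<open>The guard on \<open>e\<close> makes the bound \<open>M\<close> hold for all vectors,
  since the estimates for scores ask for a bound uniform in every argument. As the directions are
  symmetric, it preserves oddness in \<open>e\<close>.\<close>

definition cut_coord :: "'d::finite \<Rightarrow> nat \<Rightarrow> int ^ 'd \<Rightarrow> nat \<Rightarrow> real" where
  "cut_coord i M e k = (if e \<in> directions \<and> k \<le> M then real k * real_of_int (e $ i) else 0)"

lemma directions_abs_le: "e \<in> directions \<Longrightarrow> \<bar>real_of_int (e $ i)\<bar> \<le> 1"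
  by (auto simp: directions_def axis_def)

lemma cut_coord_bound: "\<bar>cut_coord i M e k\<bar> \<le> real M"
  using mult_mono[of "real k" "real M" "\<bar>real_of_int (e $ i)\<bar>" 1] directions_abs_le[of e i]
  by (auto simp: cut_coord_def abs_mult)

lemma cut_coord_odd: "cut_coord i M (- e) k = - cut_coord i M e k"
  by (simp add: cut_coord_def)

text \<open>For gaps up to \<open>M\<close> the difference is 0. Beyond that the truncated score
  vanishes, and the coordinate is at most the gap because directions have entries of absolute value
  at most 1.\<close>

lemma increment_cut:
  "snd z 0 \<in> directions \<Longrightarrow> \<bar>real_of_int (increment z $ i) - score (cut_coord i M) z\<bar> \<le> score (large M) z"
  using mult_left_mono[OF directions_abs_le[of "snd z 0" i], of "real (gap (snd z 0) (fst z))"]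
  by (simp add: increment_def score_def cut_coord_def large_def abs_mult)

lemma snd_funpow_step: "snd ((step ^^ k) z) n = snd z (k + n)"
  by (induction k arbitrary: n) (simp_all add: step_def)

section \<open>Linear growth of second moments and the almost sure limit\<close>

context stationary_points
begin

text \<open>Symmetry moves the powers of \<open>R\<close> one at a time to the other factor. With
  \<open>j = k\<close> this exhibits the inner products of even order as integrals of
  squares.\<close>

lemma inner_funpow_jump_avg:
  assumes bd: "\<And>e k. \<bar>c e k\<bar> \<le> B"
  shows "(\<integral>\<omega>. (jump_avg ^^ j) (drift c) \<omega> * (jump_avg ^^ k) (drift c) \<omega> \<partial>palm Q) =
    (\<integral>\<omega>. drift c \<omega> * (jump_avg ^^ (j + k)) (drift c) \<omega> \<partial>palm Q)"
proof (induction j arbitrary: k)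
  case (Suc j)
  let ?b = "\<lambda>k. (jump_avg ^^ k) (drift c)"
  have "(\<integral>\<omega>. ?b (Suc j) \<omega> * ?b k \<omega> \<partial>palm Q) = (\<integral>\<omega>. jump_avg (?b j) \<omega> * ?b k \<omega> \<partial>palm Q)"
    by simp
  also have "\<dots> = (\<integral>\<omega>. ?b j \<omega> * jump_avg (?b k) \<omega> \<partial>palm Q)"
    by (rule jump_avg_symmetric[OF measurable_funpow_jump_avg measurable_funpow_jump_avg
      funpow_jump_avg_bound[OF bd] funpow_jump_avg_bound[OF bd]])
  also have "\<dots> = (\<integral>\<omega>. ?b j \<omega> * ?b (Suc k) \<omega> \<partial>palm Q)" by simp
  also have "\<dots> = (\<integral>\<omega>. drift c \<omega> * ?b (j + Suc k) \<omega> \<partial>palm Q)" by (rule Suc.IH)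
  finally show ?case by simp
qed simp

text \<open>Consecutive terms pair up to \<open><b, (1 + R) b>\<close> with \<open>b = R^m a\<close>, where \<open>R\<close> is \<open>jump_avg\<close>.\<close>

lemma sum_inner_funpow_nonneg:
  assumes bd: "\<And>e k. \<bar>c e k\<bar> \<le> B"
  shows "0 \<le> (\<Sum>m<n. \<integral>\<omega>. drift c \<omega> * (jump_avg ^^ m) (drift c) \<omega> \<partial>palm Q)"
proof -
  let ?b = "\<lambda>k. (jump_avg ^^ k) (drift c)"
  define g where "g m = (\<integral>\<omega>. drift c \<omega> * ?b m \<omega> \<partial>palm Q)" for m
  have ev: "g (2 * m) = (\<integral>\<omega>. ?b m \<omega> * ?b m \<omega> \<partial>palm Q)" for m
    unfolding g_def inner_funpow_jump_avg[OF bd] by (simp add: mult_2)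
  have "g (Suc (2 * m)) = (\<integral>\<omega>. ?b m \<omega> * ?b (Suc m) \<omega> \<partial>palm Q)" for m
    unfolding g_def inner_funpow_jump_avg[OF bd] by (simp add: mult_2)
  then have od: "- g (2 * m) \<le> g (Suc (2 * m))" for m
    unfolding ev using jump_avg_lower[OF measurable_funpow_jump_avg funpow_jump_avg_bound[OF bd], of m] by simp
  have ev0: "0 \<le> g (2 * m)" for m
    unfolding ev by (rule Bochner_Integration.integral_nonneg) simp
  have *: "0 \<le> (\<Sum>m<2*k. g m)" for k
  proof (induction k)
    case (Suc k)
    then show ?case using od[of k] by simp
  qed simp
  have "0 \<le> (\<Sum>m<n. g m)"
  proof (cases "even n")
    case True
    then show ?thesis using * by (auto elim!: evenE)
  next
    \<comment> \<open>The unpaired last term has even index, hence is the integral of a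
      square.\<close>
    case False
    then obtain k where "n = Suc (2 * k)" by (auto elim!: oddE)
    then show ?thesis using *[of k] ev0[of k] by simp
  qed
  then show ?thesis by (simp only: g_def)
qed

text \<open>Reversing the first jump flips the sign of its score.\<close>

lemma score_correlation:
  assumes bd: "\<And>e k. \<bar>c e k\<bar> \<le> B" and odd: "\<And>e k. c (- e) k = - c e k"
  shows "(\<integral>z. score c z * score c ((step ^^ Suc m) z) \<partial>joint_law) =
    - (\<integral>\<omega>. drift c \<omega> * (jump_avg ^^ m) (drift c) \<omega> \<partial>palm Q)"
proof -
  let ?b = "(jump_avg ^^ m) (drift c)"
  let ?f = "\<lambda>z. score c z * score c ((step ^^ Suc m) z)"
  have [measurable]: "?f \<in> borel_measurable (config_space \<Otimes>\<^sub>M driver_law)"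
    by (intro borel_measurable_times measurable_score measurable_score_step)
  have fbd: "\<bar>?f z\<bar> \<le> B * B" for z
    by (rule abs_mult_bound) (simp_all only: score_def bd)
  have "(\<integral>z. ?f z \<partial>joint_law) = (\<integral>\<omega>. \<integral>U. ?f (\<omega>, U) \<partial>driver_law \<partial>palm Q)"
    by (rule joint.integral_fst'[symmetric])
      (rule joint.P.integrable_const_bound[of _ "B * B"], use fbd in \<open>simp_all add: measurable_joint_law\<close>)
  \<comment> \<open>With the first direction fixed, the first score is a constant in
    \<open>U\<close>, and the later one is a score \<open>m\<close> steps after the configuration
    \<open>jump e \<omega>\<close>.\<close>
  also have "\<dots> = (\<integral>\<omega>. (\<Sum>e\<in>directions. c e (gap e \<omega>) * ?b (jump e \<omega>)) / (2 * CARD('d)) \<partial>palm Q)"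
  proof (rule Bochner_Integration.integral_cong)
    fix \<omega> :: "'d config"
    have "(\<integral>U. ?f (\<omega>, U) \<partial>driver_law) = (\<Sum>e\<in>directions. \<integral>U. ?f (\<omega>, case_nat e U) \<partial>driver_law) / (2 * CARD('d))"
      by (rule integral_driver[OF measurable_section fbd]) measurable
    also have "\<dots> = (\<Sum>e\<in>directions. c e (gap e \<omega>) * ?b (jump e \<omega>)) / (2 * CARD('d))"
      unfolding funpow_Suc_apply step_case_nat integral_score_funpow[OF bd, symmetric]
      by (simp add: score_def)
    finally show "(\<integral>U. ?f (\<omega>, U) \<partial>driver_law) = \<dots>" .
  qed simp
  also have "\<dots> = (\<Sum>e\<in>directions. \<integral>\<omega>. c e (gap e \<omega>) * ?b (jump e \<omega>) \<partial>palm Q) / (2 * CARD('d))"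
    by (rule integral_average[OF _ abs_mult_bound[OF bd funpow_jump_avg_bound[OF bd]]]) measurable
  also have "(\<Sum>e\<in>directions. \<integral>\<omega>. c e (gap e \<omega>) * ?b (jump e \<omega>) \<partial>palm Q) =
      (\<Sum>e\<in>directions. - (\<integral>\<omega>. c (- e) (gap (- e) \<omega>) * ?b \<omega> \<partial>palm Q))"
    using integral_reversal[of "\<lambda>(k, \<omega>, \<omega>'). c _ k * ?b \<omega>'"] by (simp add: odd)
  also have "\<dots> = (\<Sum>e\<in>directions. - (\<integral>\<omega>. c e (gap e \<omega>) * ?b \<omega> \<partial>palm Q))"
    by (rule sum_directions_uminus[where f="\<lambda>e. - (\<integral>\<omega>. c e (gap e \<omega>) * ?b \<omega> \<partial>palm Q)"])
  also have "\<dots> / (2 * CARD('d)) = - (\<integral>\<omega>. (\<Sum>e\<in>directions. c e (gap e \<omega>) * ?b \<omega>) / (2 * CARD('d)) \<partial>palm Q)"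
    by (subst integral_average[OF _ abs_mult_bound[OF bd funpow_jump_avg_bound[OF bd]]])
      (measurable, simp add: sum_negf)
  finally show ?thesis
    by (simp add: drift_def[of c "_"] sum_distrib_right)
qed

lemma integrable_joint:
  fixes f :: "'d config \<times> (nat \<Rightarrow> int ^ 'd) \<Rightarrow> real"
  shows "f \<in> borel_measurable (config_space \<Otimes>\<^sub>M driver_law) \<Longrightarrow> (\<And>z. \<bar>f z\<bar> \<le> B) \<Longrightarrow> integrable joint_law f"
  by (rule joint.P.integrable_const_bound[of _ B]) (simp_all add: measurable_joint_law)

text \<open>The first score is split off. Its square contributes at most \<open>B^2\<close>, its
  correlations with the later scores add up to minus a nonnegative sum, and by invariance under
  \<open>step\<close> the rest has the second moment of \<open>n\<close> scores.\<close>

lemma second_moment_total: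
  assumes bd: "\<And>e k. \<bar>c e k\<bar> \<le> B" and odd: "\<And>e k. c (- e) k = - c e k"
  shows "(\<integral>z. (total_score c n z)\<^sup>2 \<partial>joint_law) \<le> real n * B\<^sup>2"
proof (induction n)
  case (Suc n)
  have sc: "\<bar>score c z\<bar> \<le> B" for z by (simp add: score_def bd)
  have I1: "integrable joint_law (\<lambda>z. score c z * score c z)"
    by (rule integrable_joint[OF _ abs_mult_bound[OF sc sc]]) measurable
  have I2: "integrable joint_law (\<lambda>z. score c z * score c ((step ^^ Suc m) z))" for m
    by (rule integrable_joint[OF _ abs_mult_bound[OF sc sc]])
      (intro borel_measurable_times measurable_score measurable_score_step)
  have I3: "integrable joint_law (\<lambda>z. total_score c n (step z) * total_score c n (step z))"
    by (rule integrable_joint[OF _ abs_mult_bound[OF total_score_bound[OF bd] total_score_bound[OF bd]]]) measurable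
  have "total_score c (Suc n) z = score c z + total_score c n (step z)" for z
    unfolding total_score_def by (simp only: sum.lessThan_Suc_shift funpow_Suc_apply) simp
  then have "(total_score c (Suc n) z)\<^sup>2 = score c z * score c z
      + 2 * (\<Sum>m<n. score c z * score c ((step ^^ Suc m) z)) + total_score c n (step z) * total_score c n (step z)" for z
    by (simp add: power2_eq_square algebra_simps sum_distrib_left total_score_def funpow_Suc_apply del: funpow.simps)
  then have "(\<integral>z. (total_score c (Suc n) z)\<^sup>2 \<partial>joint_law) = (\<integral>z. score c z * score c z \<partial>joint_law)
      + 2 * (\<Sum>m<n. \<integral>z. score c z * score c ((step ^^ Suc m) z) \<partial>joint_law)
      + (\<integral>z. total_score c n (step z) * total_score c n (step z) \<partial>joint_law)"
    using I1 I2 I3 by (simp del: funpow.simps)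
  also have "(\<integral>z. total_score c n (step z) * total_score c n (step z) \<partial>joint_law) = (\<integral>z. (total_score c n z)\<^sup>2 \<partial>distr joint_law joint_law step)"
    by (subst integral_distr) (simp_all add: measurable_joint_law power2_eq_square)
  also have "\<dots> \<le> real n * B\<^sup>2"
    unfolding distr_step by (rule Suc.IH)
  also have "(\<Sum>m<n. \<integral>z. score c z * score c ((step ^^ Suc m) z) \<partial>joint_law) \<le> 0"
    unfolding score_correlation[of c, OF bd odd] sum_negf using sum_inner_funpow_nonneg[OF bd] by simp
  also have "(\<integral>z. score c z * score c z \<partial>joint_law) \<le> (\<integral>z. B\<^sup>2 \<partial>joint_law)"
  proof (rule integral_mono[OF I1])
    show "score c z * score c z \<le> B\<^sup>2" for z
      using abs_mult_bound[OF sc[of z] sc[of z]] by (simp add: power2_eq_square)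
  qed simp
  also have "(\<integral>z. B\<^sup>2 \<partial>joint_law) = B\<^sup>2"
    by (simp add: joint.P.prob_space)
  finally show ?case by (simp add: algebra_simps)
qed (simp add: total_score_def)

lemma bounded_score_slln:
  assumes bd: "\<And>e k. \<bar>c e k\<bar> \<le> B" and odd: "\<And>e k. c (- e) k = - c e k"
  shows "AE z in joint_law. (\<lambda>n. total_score c n z / real n) \<longlonglongrightarrow> 0"
proof (rule second_moment_slln[where V="B\<^sup>2" and C=B])
  show "total_score c n \<in> borel_measurable joint_law" for n
    by (simp add: measurable_joint_law)
  show "\<bar>total_score c (Suc n) x - total_score c n x\<bar> \<le> B" for n x
    by (simp add: total_score_def score_def bd)
qed (simp_all add: joint.P.prob_space_axioms second_moment_total[of c, OF bd odd], simp add: total_score_def)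

text \<open>By Kac's lemma each gap has Palm mean at most the reciprocal of the probability that the
  origin is a point; the random first direction averages finitely many such means.\<close>

lemma integrable_gap: "integrable joint_law (score (\<lambda>e. real))"
proof (rule integrableI_nonneg)
  show "score (\<lambda>e. real) \<in> borel_measurable joint_law" by (simp add: measurable_joint_law)
  show "AE z in joint_law. 0 \<le> score (\<lambda>e. real) z" by (simp add: score_def)
  have gapfin: "(\<integral>\<^sup>+\<omega>. of_nat (gap e \<omega>) \<partial>palm Q) < \<infinity>" for e
  proof -
    have "(\<integral>\<^sup>+\<omega>. of_nat (gap e \<omega>) \<partial>palm Q) =
        (\<integral>\<^sup>+\<omega>. of_nat (gap e \<omega>) * indicator {\<omega>. \<omega> 0} \<omega> \<partial>Q) / emeasure Q {\<omega>. \<omega> 0}"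
      unfolding palm_def points_def by (subst nn_integral_uniform_measure) simp_all
    then show ?thesis
      using nn_integral_gap_le[of e] origin_pos
      by (auto simp: ennreal_divide_eq_top_iff less_top[symmetric] top_unique)
  qed
  have "(\<integral>\<^sup>+z. ennreal (score (\<lambda>e. real) z) \<partial>joint_law) =
      (\<integral>\<^sup>+\<omega>. \<integral>\<^sup>+U. of_nat (gap (U 0) \<omega>) \<partial>driver_law \<partial>palm Q)"
    by (subst drivers.nn_integral_fst[symmetric])
      (simp_all add: measurable_joint_law score_def ennreal_of_nat_eq_real_of_nat)
  also have "\<dots> = (\<integral>\<^sup>+\<omega>. (\<Sum>e\<in>directions. of_nat (gap e \<omega>)) / of_nat (2 * CARD('d)) \<partial>palm Q)"
  proof (rule nn_integral_cong)
    fix \<omega> :: "'d config"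
    have "(\<lambda>U. of_nat (gap (U 0) \<omega>) :: ennreal) \<in> borel_measurable driver_law"
      by (rule measurable_compose[OF measurable_driver]) simp
    from nn_integral_driver[OF this]
    show "(\<integral>\<^sup>+U. of_nat (gap (U 0) \<omega>) \<partial>driver_law) = (\<Sum>e\<in>directions. of_nat (gap e \<omega>)) / of_nat (2 * CARD('d))"
      by (simp add: drivers.emeasure_space_1[simplified])
  qed
  also have "\<dots> = (\<Sum>e\<in>directions. \<integral>\<^sup>+\<omega>. of_nat (gap e \<omega>) \<partial>palm Q) / of_nat (2 * CARD('d))"
    by (subst nn_integral_divide, measurable, subst nn_integral_sum, measurable)
  also have "\<dots> < \<infinity>"
    using gapfin by (auto simp: less_top[symmetric] ennreal_divide_eq_top_iff)
  finally show "(\<integral>\<^sup>+z. ennreal (score (\<lambda>e. real) z) \<partial>joint_law) < \<infinity>" .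
qed

lemma integrable_large: "integrable joint_law (score (large M))"
  by (rule Bochner_Integration.integrable_bound[OF integrable_gap])
    (auto simp: measurable_joint_law score_def large_def)

lemma integral_large_tendsto: "(\<lambda>M. \<integral>z. score (large M) z \<partial>joint_law) \<longlonglongrightarrow> 0"
proof -
  have "(\<lambda>M. \<integral>z. score (large M) z \<partial>joint_law) \<longlonglongrightarrow> (\<integral>z. 0 \<partial>joint_law)"
  proof (rule integral_dominated_convergence[OF _ _ integrable_gap])
    show "AE z in joint_law. (\<lambda>M. score (large M) z) \<longlonglongrightarrow> 0"
    proof (rule AE_I2)
      fix z
      have "\<forall>\<^sub>F M in sequentially. score (large M) z = 0"
        by (rule eventually_sequentiallyI[of "gap (snd z 0) (fst z)"]) (simp add: score_def large_def)
      then show "(\<lambda>M. score (large M) z) \<longlonglongrightarrow> 0" by (rule tendsto_eventually)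
    qed
  qed (auto simp: measurable_joint_law score_def large_def)
  then show ?thesis by simp
qed

text \<open>The event that every truncation level fails lies, for each \<open>M\<close>, in the
  event that level \<open>M\<close> fails. The latter has probability at most the mean of
  \<open>score (large M)\<close> divided by \<open>l\<close>, which tends to 0. The level depends on
  the sample point but not on \<open>n\<close>.\<close>

lemma AE_total_large:
  assumes l: "0 < l"
  shows "AE z in joint_law. \<exists>M. \<forall>n. total_score (large M) n z \<le> l * real n"
proof -
  let ?A = "\<lambda>M. {z \<in> space joint_law. \<exists>n. l * real n < total_score (large M) n z}"
  let ?N = "{z \<in> space joint_law. \<forall>M. \<exists>n. l * real n < total_score (large M) n z}"
  have [measurable]: "total_score c n \<in> borel_measurable joint_law" for c n
    by (simp add: measurable_joint_law)
  have bound: "measure joint_law ?N \<le> (\<integral>z. score (large M) z \<partial>joint_law) / l" for M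
  proof -
    have "?A M \<in> sets joint_law" by measurable
    then have "measure joint_law ?N \<le> measure joint_law (?A M)"
      by (intro joint.P.finite_measure_mono) auto
    also have "\<dots> \<le> (\<integral>z. score (large M) z \<partial>joint_law) / l"
      unfolding total_score_def
      by (rule maximal_inequality[OF joint.P.prob_space_axioms _ distr_step integrable_large _ l])
        (simp_all add: measurable_joint_law, simp_all add: score_def large_def)
    finally show ?thesis .
  qed
  have "(\<lambda>M. (\<integral>z. score (large M) z \<partial>joint_law) / l) \<longlonglongrightarrow> 0 / l"
    by (intro tendsto_divide integral_large_tendsto tendsto_const) (use l in simp)
  then have "measure joint_law ?N \<le> 0"
    using bound by (intro LIMSEQ_le_const[of _ "0::real"]) auto
  then have "emeasure joint_law ?N = 0"
    by (simp add: joint.P.emeasure_eq_measure measure_le_0_iff)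
  then show ?thesis
    by (rule AE_I[rotated]) (measurable, auto simp: not_le)
qed

text \<open>The level \<open>M\<close> that controls the tail is random, so the strong law for
  truncated scores is first secured for all \<open>M\<close> simultaneously.\<close>

lemma AE_walk_coordinate:
  "AE z in joint_law. (\<lambda>n. real_of_int (walk z n $ i) / real n) \<longlonglongrightarrow> 0"
proof -
  have "AE z in joint_law. \<forall>M. (\<lambda>n. total_score (cut_coord i M) n z / real n) \<longlonglongrightarrow> 0"
    unfolding AE_all_countable by (intro allI bounded_score_slln[of "cut_coord i _", OF cut_coord_bound cut_coord_odd])
  moreover have "AE z in joint_law. \<forall>j::nat. \<exists>M. \<forall>n. total_score (large M) n z \<le> 1 / real (Suc j) * real n"
    unfolding AE_all_countable by (intro allI AE_total_large) simp
  moreover have "AE z in joint_law. \<forall>n. snd z n \<in> directions"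
  proof (rule joint.AE_pair_measure)
    show "{z \<in> space joint_law. \<forall>n. snd z n \<in> directions} \<in> sets joint_law" by measurable
  qed (simp add: AE_driver)
  ultimately show ?thesis
  proof eventually_elim
    case (elim z)
    have close: "\<bar>real_of_int (walk z n $ i) - total_score (cut_coord i M) n z\<bar> \<le> total_score (large M) n z" for n M
    proof -
      have "real_of_int (walk z n $ i) - total_score (cut_coord i M) n z =
          (\<Sum>k<n. real_of_int (increment ((step ^^ k) z) $ i) - score (cut_coord i M) ((step ^^ k) z))"
        by (simp add: walk_def total_score_def sum_subtractf)
      also have "\<bar>\<dots>\<bar> \<le> total_score (large M) n z"
        unfolding total_score_def by (rule order_trans[OF sum_abs])
          (intro sum_mono increment_cut, simp add: snd_funpow_step elim)
      finally show ?thesis .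
    qed
    show ?case
    proof (rule LIMSEQ_I)
      fix r :: real assume "0 < r"
      \<comment> \<open>One half of \<open>r\<close> is reserved for the tail, the other for the
        truncated sum.\<close>
      then obtain j where j: "inverse (real (Suc j)) < r / 2"
        using reals_Archimedean[of "r / 2"] by auto
      from elim obtain M where M: "\<And>n. total_score (large M) n z \<le> 1 / real (Suc j) * real n" by blast
      from elim \<open>0 < r\<close> obtain n0 where n0: "\<And>n. n0 \<le> n \<Longrightarrow> norm (total_score (cut_coord i M) n z / real n - 0) < r / 2"
        using LIMSEQ_D[of "\<lambda>n. total_score (cut_coord i M) n z / real n" 0 "r / 2"] by auto
      have "norm (real_of_int (walk z n $ i) / real n - 0) < r" if "n0 \<le> n" for n
      proof (cases "n = 0")
        case False
        have "\<bar>real_of_int (walk z n $ i) / real n - total_score (cut_coord i M) n z / real n\<bar>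
            = \<bar>real_of_int (walk z n $ i) - total_score (cut_coord i M) n z\<bar> / real n"
          by (simp flip: diff_divide_distrib)
        also have "\<dots> \<le> (1 / real (Suc j) * real n) / real n"
          by (intro divide_right_mono order_trans[OF close M]) simp
        also have "\<dots> = inverse (real (Suc j))" using False by (simp add: inverse_eq_divide)
        finally show ?thesis using n0[OF that] j unfolding real_norm_def diff_zero by linarith
      qed (use \<open>0 < r\<close> in simp)
      then show "\<exists>no. \<forall>n\<ge>no. norm (real_of_int (walk z n $ i) / real n - 0) < r" by blast
    qed
  qed
qed

end

section \<open>The annealed law\<close>

text \<open>With only countable quantifiers left, convergence to 0 defines a measurable set of
  trajectories.\<close>

lemma LIMSEQ_zero_iff_countable:
  fixes f :: "nat \<Rightarrow> real"
  shows "f \<longlonglongrightarrow> 0 \<longleftrightarrow> (\<forall>j. \<exists>N. \<forall>n\<ge>N. \<bar>f n\<bar> < inverse (real (Suc j)))"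
proof
  assume "f \<longlonglongrightarrow> 0"
  then show "\<forall>j. \<exists>N. \<forall>n\<ge>N. \<bar>f n\<bar> < inverse (real (Suc j))"
    using LIMSEQ_D[of f 0] by simp
next
  assume *: "\<forall>j. \<exists>N. \<forall>n\<ge>N. \<bar>f n\<bar> < inverse (real (Suc j))"
  show "f \<longlonglongrightarrow> 0"
  proof (rule LIMSEQ_I)
    fix r :: real assume "0 < r"
    then obtain j where "inverse (real (Suc j)) < r" using reals_Archimedean by blast
    moreover from * obtain N where "\<forall>n\<ge>N. \<bar>f n\<bar> < inverse (real (Suc j))" by blast
    ultimately show "\<exists>no. \<forall>n\<ge>no. norm (f n - 0) < r" by force
  qed
qed

definition zero_speed :: "(nat \<Rightarrow> int ^ 'd::finite) \<Rightarrow> bool" where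
  "zero_speed X \<longleftrightarrow> (\<forall>i. (\<lambda>n. real_of_int (X n $ i) / real n) \<longlonglongrightarrow> 0)"

lemma zero_speed_iff: "zero_speed X \<longleftrightarrow> (\<lambda>n. (1 / real n) *\<^sub>R to_real_vec (X n)) \<longlonglongrightarrow> 0"
  unfolding zero_speed_def
proof
  assume "\<forall>i. (\<lambda>n. real_of_int (X n $ i) / real n) \<longlonglongrightarrow> 0"
  then show "(\<lambda>n. (1 / real n) *\<^sub>R to_real_vec (X n)) \<longlonglongrightarrow> 0"
    by (intro vec_tendstoI) (simp add: to_real_vec_def)
next
  assume "(\<lambda>n. (1 / real n) *\<^sub>R to_real_vec (X n)) \<longlonglongrightarrow> 0"
  from tendsto_vec_nth[OF this] show "\<forall>i. (\<lambda>n. real_of_int (X n $ i) / real n) \<longlonglongrightarrow> 0"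
    by (simp add: to_real_vec_def)
qed

lemma sets_zero_speed: "{X :: nat \<Rightarrow> int ^ 'd::finite. zero_speed X} \<in> sets (\<Pi>\<^sub>M n\<in>UNIV. count_space UNIV)"
proof -
  let ?T = "\<Pi>\<^sub>M n\<in>(UNIV :: nat set). count_space (UNIV :: (int ^ 'd) set)"
  have [measurable]: "(\<lambda>X. \<bar>real_of_int (X n $ i) / real n\<bar>) \<in> borel_measurable ?T" for i n
    by (rule measurable_compose[OF measurable_component_singleton[of n]]) simp_all
  have "{X \<in> space ?T. zero_speed X} \<in> sets ?T"
    unfolding zero_speed_def LIMSEQ_zero_iff_countable by measurable
  then show ?thesis by (simp add: space_PiM)
qed

context stationary_points
begin

lemma AE_quenched:
  "AE \<omega> in palm Q. distr driver_law (\<Pi>\<^sub>M n\<in>UNIV. count_space UNIV) (\<lambda>U. walk (\<omega>, U)) = quenched_law \<omega>"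
proof (rule AE_palmI)
  show "AE \<omega> in Q. \<omega> 0 \<longrightarrow>
      distr driver_law (\<Pi>\<^sub>M n\<in>UNIV. count_space UNIV) (\<lambda>U. walk (\<omega>, U)) = quenched_law \<omega>"
    using recurrent by eventually_elim (auto intro!: distr_walk)
qed

text \<open>Fubini turns the almost sure statement on the product space into one for almost every
  environment, where the driven walk has the quenched law; integrating over the environments gives
  1.\<close>

lemma annealed_zero_speed: "emeasure (annealed_law Q) {X. zero_speed X} = 1"
proof -
  let ?T = "\<Pi>\<^sub>M n\<in>(UNIV :: nat set). count_space (UNIV :: (int ^ 'd) set)"
  have "AE z in joint_law. zero_speed (walk z)"
  proof -
    have "AE z in joint_law. \<forall>i\<in>UNIV. (\<lambda>n. real_of_int (walk z n $ i) / real n) \<longlonglongrightarrow> 0"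
      by (rule AE_finite_allI) (simp_all add: AE_walk_coordinate)
    then show ?thesis by (simp add: zero_speed_def)
  qed
  then have "AE \<omega> in palm Q. AE U in driver_law. zero_speed (walk (\<omega>, U))"
    by (rule joint.AE_pair)
  with AE_quenched have "AE \<omega> in palm Q. emeasure (quenched_law \<omega>) {X. zero_speed X} = 1"
  proof eventually_elim
    case (elim \<omega>)
    have w: "(\<lambda>U. walk (\<omega>, U)) \<in> measurable driver_law ?T"
      by (rule measurable_PiM_single') (auto simp: space_PiM)
    interpret W: prob_space "distr driver_law ?T (\<lambda>U. walk (\<omega>, U))"
      by (rule drivers.prob_space_distr[OF w])
    have "AE X in distr driver_law ?T (\<lambda>U. walk (\<omega>, U)). zero_speed X"
      using elim sets_zero_speed by (subst AE_distr_iff[OF w]) (simp_all add: space_PiM)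
    then have "emeasure (distr driver_law ?T (\<lambda>U. walk (\<omega>, U))) {X. zero_speed X} = 1"
      using sets_zero_speed by (intro W.emeasure_eq_1_AE) simp_all
    then show ?case by (simp only: elim)
  qed
  then have "emeasure (annealed_law Q) {X. zero_speed X} = (\<integral>\<^sup>+\<omega>. 1 \<partial>palm Q)"
    unfolding emeasure_annealed_law[OF sets_Q sets_zero_speed] by (rule nn_integral_cong_AE)
  then show ?thesis by (simp add: palm.emeasure_space_1[simplified])
qed

end

text \<open>The vectors whose shift preserves \<open>Q\<close> form a subgroup of the lattice, and
  the unit vectors generate the lattice.\<close>

lemma stationary_all_shifts:
  fixes Q :: "'d::finite config measure"
  assumes sQ: "sets Q = sets config_space" and ax: "\<And>i. distr Q Q (shift (axis i 1)) = Q"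
  shows "distr Q Q (shift x) = Q"
proof -
  have m [measurable]: "shift x \<in> measurable Q Q" for x
    using measurable_shift sQ by (simp cong: measurable_cong_sets)
  have zero: "distr Q Q (shift 0) = Q"
  proof -
    have "(shift 0 :: 'd config \<Rightarrow> 'd config) = (\<lambda>\<omega>. \<omega>)" by (rule ext) simp
    then show ?thesis by (simp only: distr_id)
  qed
  have add: "distr Q Q (shift (x + y)) = Q" if "distr Q Q (shift x) = Q" "distr Q Q (shift y) = Q" for x y
    using that distr_distr[OF m m, of x y] by (simp add: comp_def add.commute)
  have neg: "distr Q Q (shift (- x)) = Q" if x: "distr Q Q (shift x) = Q" for x
    using zero distr_distr[OF m m, of x "- x"] by (simp add: comp_def x)
  have nat: "distr Q Q (shift (int k *s axis i 1)) = Q" for k i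
    by (induction k) (simp_all add: zero ax add vector_sadd_rdistrib)
  have int: "distr Q Q (shift (k *s axis i 1)) = Q" for k i
  proof (cases "0 \<le> k")
    case False
    then have "k *s axis i 1 = - (int (nat (- k)) *s (axis i 1 :: int ^ 'd))" by (simp add: vec_eq_iff)
    then show ?thesis using neg[OF nat] by metis
  qed (use nat[of "nat k"] in simp)
  have "distr Q Q (shift (\<Sum>i\<in>A. x $ i *s axis i 1)) = Q" if "finite A" for A
    using that by (induction A) (simp_all add: zero add int)
  then show ?thesis using basis_expansion[of x] by (metis finite)
qed

theorem theorem1p9:
  fixes Q :: "'d::finite config measure"
  assumes "prob_space Q"
    and "sets Q = sets config_space"
    and "\<And>i. stationary_ergodic Q (shift (axis i 1))"
    and "measure Q {\<omega> \<in> space Q. points \<omega> = {}} < 1"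
  shows "measure (annealed_law Q)
           {X \<in> space (annealed_law Q).
              (\<lambda>n. (1 / real n) *\<^sub>R to_real_vec (X n)) \<longlonglongrightarrow> 0} = 1"
proof -
  interpret stationary_field Q
    using assms(1-3) stationary_all_shifts[of Q]
    by (auto simp: stationary_field_def stationary_field_axioms_def stationary_ergodic_def)
  \<comment> \<open>If the origin were almost surely empty, stationarity would make each of the
    countably many sites almost surely empty, so that there would be no points at all with
    probability 1.\<close>
  have "emeasure Q {\<omega>. \<omega> 0} \<noteq> 0"
  proof
    assume null: "emeasure Q {\<omega>. \<omega> 0} = 0"
    have "AE \<omega> in Q. \<not> \<omega> 0"
      using null AE_iff_measurable[of "{\<omega>. \<omega> 0}" Q "\<lambda>\<omega>. \<not> \<omega> 0"] origin_sets by simp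
    then have "AE \<omega> in Q. \<not> \<omega> x" for x
      using AE_shift[of "\<lambda>\<omega>. \<not> \<omega> 0" x] by (simp add: shift_apply)
    then have "AE \<omega> in Q. \<forall>x. \<not> \<omega> x" unfolding AE_all_countable by blast
    then have "AE \<omega> in Q. \<omega> \<in> {\<omega> \<in> space Q. points \<omega> = {}}"
      by eventually_elim (simp add: points_def)
    moreover have "{\<omega>. \<forall>x. \<not> \<omega> x} \<in> sets config_space" by (rule Collect_config_sets) measurable
    then have "{\<omega> \<in> space Q. points \<omega> = {}} \<in> sets Q" by (simp add: points_def)
    ultimately have "measure Q {\<omega> \<in> space Q. points \<omega> = {}} = 1" by (simp add: prob_eq_1)
    with assms(4) show False by simp
  qed
  then interpret stationary_points Q by unfold_locales
  have "sets (annealed_law Q) = sets (\<Pi>\<^sub>M n\<in>UNIV. count_space UNIV)"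
    unfolding annealed_law_def
    by (rule sets_bind) (simp_all add: quenched_law_def)
  from sets_eq_imp_space_eq[OF this] have "space (annealed_law Q) = UNIV" by (simp add: space_PiM)
  then show ?thesis
    using annealed_zero_speed by (simp add: measure_def zero_speed_iff)
qed

end
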